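(* Let $(\mathbb A,\mathbb B)$ and $(\mathbb A',\mathbb B')$ be PCSP templates with polymorphism minions $\mathcal M=\mathrm{Pol}(\mathbb A,\mathbb B)$ and $\mathcal M'=\mathrm{Pol}(\mathbb A',\mathbb B')$, and let $k\in\mathbb N$. Then $\mathrm{PCSP}(\mathbb A',\mathbb B')$ reduces to $\mathrm{PCSP}(\mathbb A,\mathbb B)$ via the $k$-consistency reduction (defined using the $k$-th saturated power) if and only if there is a minion homomorphism from $\mathrm{lvl}_k(\omega\mathcal M)$ to $\mathcal M'$.
   Context: An LC (label cover) instance $\mathcal D$ consists of a finite set $X$ of variables, a finite set $\mathcal D_x$ (domain) for each $x\in X$, and a finite list of constraints of the form $x=\alpha(y)$ with $x,y\in X$ and $\alpha:\mathcal D_y\to\mathcal D_x$ a function; it is discrete if it has no constraints. A minion $\mathcal R$ is a functor from finite sets to sets: it assigns a set $\mathcal R^{(D)}$ to each finite set $D$ and a map $\mathcal R^{(\alpha)}:\mathcal R^{(D)}\to\mathcal R^{(E)}$ to each function $\alpha:D\to E$ between finite sets, preserving identities and composition. A solution of $\mathcal D$ in $\mathcal R$ is a tuple $(r_x)_{x\in X}$ with $r_x\in\mathcal R^{(\mathcal D_x)}$ and $r_x=\mathcal R^{(\alpha)}(r_y)$ for every constraint $x=\alpha(y)$ of $\mathcal D$. A minion homomorphism $\mathcal R\to\mathcal S$ is a family of functions $\xi^{(D)}:\mathcal R^{(D)}\to\mathcal S^{(D)}$, indexed by all finite sets $D$, with $\xi^{(E)}\circ\mathcal R^{(\alpha)}=\mathcal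 S^{(\alpha)}\circ\xi^{(D)}$ for every $\alpha:D\to E$. The $k$-th saturated power $\mathrm{pow}_k\,\mathcal D$ is the LC instance with variable set $X^k$, domains $\mathcal D_{x_1x_2\dots x_k}=\mathcal D_{x_1}\times\cdots\times\mathcal D_{x_k}$, and the following constraints, where first all constraints $x=\mathrm{id}(x)$ ($x\in X$) are added to $\mathcal D$: (1) for every $k$-tuple of constraints $x_i=\alpha_i(y_i)$, $i=1,\dots,k$, of $\mathcal D$, the constraint $x_1\dots x_k=(\alpha_1\times\cdots\times\alpha_k)(y_1\dots y_k)$; (2) for every $x_1\dots x_k\in X^k$ and every function $\sigma:[k]\to[k]$, the constraint $x_{\sigma(1)}\dots x_{\sigma(k)}=\sigma^*(x_1\dots x_k)$, where $\sigma^*(d_1\dots d_k)=d_{\sigma(1)}\dots d_{\sigma(k)}$. The $k$-th level $\mathrm{lvl}_k\,\mathcal R$ of a minion $\mathcal R$ is defined as follows. Elements of $(\mathrm{lvl}_k\,\mathcal R)^{(C)}$ are triples $(\mathcal E,r,w)$ where $\mathcal E$ is a discrete LC instance with variable set $Y$; $r=(r_{\bar y})_{\bar y\in Y^k}$ is a solution of $\mathrm{pow}_k\,\mathcal E$ in $\mathcal R$; and $w=(w_{\bar y})_{\bar y\in Y^{k-1}}$ is a tuple with $w_{\bar y}\in\mathcal R^{(C\times\mathcal E_{y_1}\times\cdots\times\mathcal E_{y_{k-1}})}$ such that there exist $z\in Y$ and a map $\beta:\mathcal E_z\to C$ with $w_{\bar y}=\mathcal R^{(\beta\times\mathrm{id}\times\cdots\times\mathrm{id})}(r_{zy_1\dots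 y_{k-1}})$ for all $\bar y\in Y^{k-1}$. For $\alpha:C\to C'$, $(\mathrm{lvl}_k\,\mathcal R)^{(\alpha)}(\mathcal E,r,w)=(\mathcal E,r,w')$ with $w'_{\bar y}=\mathcal R^{(\alpha\times\mathrm{id}\times\cdots\times\mathrm{id})}(w_{\bar y})$. For a minion $\mathcal R$, $d\in D$ and $r\in\mathcal R^{(D)}$, we say that $d$ is dummy in $r$ (a dummy of $r$) if there are a map $\alpha:D''\to D$ and $r''\in\mathcal R^{(D'')}$ such that $d$ is not in the image of $\alpha$ and $r=\mathcal R^{(\alpha)}(r'')$. The minion $\omega\mathcal R$: $(\omega\mathcal R)^{(D)}$ is the set of pairs $(D',r)$ where $D'\subseteq D$, $r\in\mathcal R^{(D)}$, and all elements $d\in D\setminus D'$ are dummies of $r$; for $\alpha:D\to E$, $(\omega\mathcal R)^{(\alpha)}(D',r)=(\alpha(D'),\mathcal R^{(\alpha)}(r))$. A structure $\mathbb A$ in a signature $\Sigma$ (a set of relation symbols $R$ with arities $\mathrm{ar}(R)\in\mathbb N$) consists of a finite set $A$ and a relation $R^{\mathbb A}\subseteq A^{\mathrm{ar}(R)}$ for each $R\in\Sigma$. A homomorphism is a relation-preserving map. A PCSP template is a pair $(\mathbb A,\mathbb B)$ of structures in the same finite signature such that there is a homomorphism $\mathbb A\to\mathbb B$ (the two templates in the claim may have different signatures). An instance $\mathcal I$ of $\mathrm{PCSP}(\mathbb A,\mathbb B)$ is a list of formal constraints $x_1\dots x_n\in R$ with $R\in\Sigma$, $n=\mathrm{ar}(R)$,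 and $x_i$ variables. A solution of $\mathcal I$ in $\mathbb B$ is a map $s$ from variables to $B$ with $s(x_1)\dots s(x_n)\in R^{\mathbb B}$ for each constraint (similarly for $\mathbb A$); the task is to distinguish instances solvable in $\mathbb A$ from those not even solvable in $\mathbb B$. The LC instance $\mathrm{lc}_{\mathbb A}(\mathcal I)$ has as variables the variables of $\mathcal I$, each with domain $A$, together with one variable $y$ with domain $R^{\mathbb A}$ for each constraint $x_1\dots x_n\in R$ of $\mathcal I$, with LC constraints $x_i=\pi_i(y)$, $i=1,\dots,n$, where $\pi_i$ is the $i$-th projection. The polymorphism minion $\mathcal M=\mathrm{Pol}(\mathbb A,\mathbb B)$: $\mathcal M^{(D)}$ is the set of homomorphisms from the Cartesian power $\mathbb A^D$ to $\mathbb B$; for $\alpha:D\to E$ and $f\in\mathcal M^{(D)}$, $\mathcal M^{(\alpha)}(f):\mathbb A^E\to\mathbb B$ is $a\mapsto f(a\circ\alpha)$. For an LC instance $\mathcal D$, $\mathrm{arc}(\mathcal D)$ is the LC instance obtained by replacing the domains $\mathcal D_x$ with the largest subsets $\mathcal D'_x\subseteq\mathcal D_x$ such that $\mathcal D'_x=\alpha(\mathcal D'_y)$ for every constraint $x=\alpha(y)$ of $\mathcal D$, and restricting the constraint maps accordingly. For an LC instance $\mathcal D$ with variable set $X$, $\mathrm{csp}_{\mathbb A}(\mathcal D)$ denotes the standard reduction from label cover to instances of $\mathrm{PCSP}(\mathbb A,\mathbb B)$: its variables are the pairs $(x,a)$ with $x\in X$, $a\in A^{\mathcal D_x}$, modulo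 the equivalence relation generated by $(x,a)\sim(y,a\circ\alpha)$ for every constraint $x=\alpha(y)$ of $\mathcal D$ and every $a\in A^{\mathcal D_x}$; its constraints are $(x,a_1)\dots(x,a_n)\in R$ for every symbol $R$ of arity $n$, every $x\in X$, and all $a_1,\dots,a_n\in A^{\mathcal D_x}$ with $a_1(d)\dots a_n(d)\in R^{\mathbb A}$ for all $d\in\mathcal D_x$. (Solutions of $\mathcal D$ in $\mathrm{Pol}(\mathbb A,\mathbb B)$ are in one-to-one correspondence with solutions of $\mathrm{csp}_{\mathbb A}(\mathcal D)$ in $\mathbb B$.) The $k$-consistency reduction (defined using the $k$-th saturated power) maps an instance $\mathcal I$ of $\mathrm{PCSP}(\mathbb A',\mathbb B')$ to $\mathcal I^\sharp=\mathrm{csp}_{\mathbb A}(\mathrm{arc}(\mathrm{pow}_k\,\mathrm{lc}_{\mathbb A'}(\mathcal I)))$. $\mathrm{PCSP}(\mathbb A',\mathbb B')$ reduces to $\mathrm{PCSP}(\mathbb A,\mathbb B)$ via it if for every instance $\mathcal I$ of $\mathrm{PCSP}(\mathbb A',\mathbb B')$: if $\mathcal I$ has a solution in $\mathbb A'$, then $\mathcal I^\sharp$ has a solution in $\mathbb A$; and if $\mathcal I^\sharp$ has a solution in $\mathbb B$, then $\mathcal I$ has a solution in $\mathbb B'$.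
   Formalization: In ωR, pairs (∅, r) over D are also required to have r in the image of R^(∅) → R^(D); without this ωM need not be a minion (e.g. if a relation of A is empty), and nothing changes when it is. Also k ≥ 1, and instances may have variables in no constraint. *)

theory Defs
  imports Main "HOL-Library.FuncSet"
begin

section \<open>Finite sets\<close>

text \<open>
  ``All finite sets'' are the finite subsets of the type \<open>'c elt\<close>.  It is infinite, contains
  the points of \<open>'c\<close> as atoms and is closed under forming tuples, so that all products used below
  are again finite subsets of \<open>'c elt\<close>.  A map \<open>D \<rightarrow> E\<close> is given by
  a function in \<open>D \<rightarrow> E\<close>; its values outside \<open>D\<close> are irrelevant.
\<close>

datatype 'c elt = Atom 'c | Tup (comps: "'c elt list")

definition tuples :: "nat \<Rightarrow> 'a set \<Rightarrow> 'a list set" where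
  "tuples k A = {xs. length xs = k \<and> set xs \<subseteq> A}"

definition set_prod :: "'c elt set list \<Rightarrow> 'c elt set" where
  "set_prod Ds = Tup ` listset Ds"

definition prod_map :: "('c elt \<Rightarrow> 'c elt) list \<Rightarrow> 'c elt \<Rightarrow> 'c elt" where
  "prod_map fs u = Tup (map2 (\<lambda>f d. f d) fs (comps u))"


section \<open>Minions\<close>

text \<open>\<open>mor R D E \<alpha>\<close> is the map from \<open>obj R D\<close> to \<open>obj R E\<close> assigned to \<open>\<alpha> : D \<rightarrow> E\<close>.\<close>

record ('u, 'm) minion =
  obj :: "'u set \<Rightarrow> 'm set"
  mor :: "'u set \<Rightarrow> 'u set \<Rightarrow> ('u \<Rightarrow> 'u) \<Rightarrow> 'm \<Rightarrow> 'm"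

definition is_minion :: "('u, 'm) minion \<Rightarrow> bool" where
  "is_minion R \<longleftrightarrow>
     (\<forall>D E \<alpha>. finite D \<longrightarrow> finite E \<longrightarrow> \<alpha> \<in> D \<rightarrow> E \<longrightarrow> mor R D E \<alpha> \<in> obj R D \<rightarrow> obj R E) \<and>
     (\<forall>D E \<alpha> \<beta>. finite D \<longrightarrow> finite E \<longrightarrow> \<alpha> \<in> D \<rightarrow> E \<longrightarrow> (\<forall>d\<in>D. \<alpha> d = \<beta> d) \<longrightarrow>
        (\<forall>r\<in>obj R D. mor R D E \<alpha> r = mor R D E \<beta> r)) \<and>
     (\<forall>D. finite D \<longrightarrow> (\<forall>r\<in>obj R D. mor R D D id r = r)) \<and>
     (\<forall>D E F \<alpha> \<beta>. finite D \<longrightarrow> finite E \<longrightarrow> finite F \<longrightarrow> \<alpha> \<in> D \<rightarrow> E \<longrightarrow> \<beta> \<in> E \<rightarrow> F \<longrightarrow>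
        (\<forall>r\<in>obj R D. mor R D F (\<beta> \<circ> \<alpha>) r = mor R E F \<beta> (mor R D E \<alpha> r)))"

lemma is_minionI:
  assumes "\<And>D E \<alpha> r. finite D \<Longrightarrow> finite E \<Longrightarrow> \<alpha> \<in> D \<rightarrow> E \<Longrightarrow> r \<in> obj R D \<Longrightarrow> mor R D E \<alpha> r \<in> obj R E"
    and "\<And>D E \<alpha> \<beta> r. finite D \<Longrightarrow> finite E \<Longrightarrow> \<alpha> \<in> D \<rightarrow> E \<Longrightarrow> (\<And>d. d \<in> D \<Longrightarrow> \<alpha> d = \<beta> d) \<Longrightarrow>
      r \<in> obj R D \<Longrightarrow> mor R D E \<alpha> r = mor R D E \<beta> r"
    and "\<And>D r. finite D \<Longrightarrow> r \<in> obj R D \<Longrightarrow> mor R D D id r = r"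
    and "\<And>D E F \<alpha> \<beta> r. finite D \<Longrightarrow> finite E \<Longrightarrow> finite F \<Longrightarrow> \<alpha> \<in> D \<rightarrow> E \<Longrightarrow> \<beta> \<in> E \<rightarrow> F \<Longrightarrow>
      r \<in> obj R D \<Longrightarrow> mor R D F (\<beta> \<circ> \<alpha>) r = mor R E F \<beta> (mor R D E \<alpha> r)"
  shows "is_minion R"
  unfolding is_minion_def
  by (intro conjI allI impI ballI funcsetI; (rule assms; simp))

lemma
  assumes "is_minion R"
  shows minion_mor: "finite D \<Longrightarrow> finite E \<Longrightarrow> \<alpha> \<in> D \<rightarrow> E \<Longrightarrow> r \<in> obj R D \<Longrightarrow> mor R D E \<alpha> r \<in> obj R E"
    and minion_cong: "finite D \<Longrightarrow> finite E \<Longrightarrow> \<alpha> \<in> D \<rightarrow> E \<Longrightarrow> (\<And>d. d \<in> D \<Longrightarrow> \<alpha> d = \<beta> d) \<Longrightarrow>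
      r \<in> obj R D \<Longrightarrow> mor R D E \<alpha> r = mor R D E \<beta> r"
    and minion_id: "finite D \<Longrightarrow> r \<in> obj R D \<Longrightarrow> mor R D D id r = r"
    and minion_comp: "finite D \<Longrightarrow> finite E \<Longrightarrow> finite F \<Longrightarrow> \<alpha> \<in> D \<rightarrow> E \<Longrightarrow> \<beta> \<in> E \<rightarrow> F \<Longrightarrow>
      r \<in> obj R D \<Longrightarrow> mor R D F (\<beta> \<circ> \<alpha>) r = mor R E F \<beta> (mor R D E \<alpha> r)"
     apply (use assms in \<open>auto simp: is_minion_def Pi_iff\<close>)[1]
    apply (use assms in \<open>simp add: is_minion_def\<close>)[1]
   apply (use assms in \<open>simp add: is_minion_def\<close>)[1]
  apply (use assms in \<open>simp add: is_minion_def\<close>)[1]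
  done

definition minion_hom ::
    "('u set \<Rightarrow> 'm \<Rightarrow> 'n) \<Rightarrow> ('u, 'm) minion \<Rightarrow> ('u, 'n) minion \<Rightarrow> bool" where
  "minion_hom \<xi> R S \<longleftrightarrow>
     (\<forall>D. finite D \<longrightarrow> \<xi> D \<in> obj R D \<rightarrow> obj S D) \<and>
     (\<forall>D E \<alpha>. finite D \<longrightarrow> finite E \<longrightarrow> \<alpha> \<in> D \<rightarrow> E \<longrightarrow>
        (\<forall>r\<in>obj R D. \<xi> E (mor R D E \<alpha> r) = mor S D E \<alpha> (\<xi> D r)))"


section \<open>Label cover instances\<close>

text \<open>The constraint \<open>x = \<alpha>(y)\<close> is the triple \<open>(x, \<alpha>, y)\<close>.\<close>

record ('v, 'u) lc =
  lvars :: "'v set"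
  ldom :: "'v \<Rightarrow> 'u set"
  lcons :: "('v \<times> ('u \<Rightarrow> 'u) \<times> 'v) set"

definition is_lc :: "('v, 'u) lc \<Rightarrow> bool" where
  "is_lc \<D> \<longleftrightarrow> finite (lvars \<D>) \<and> (\<forall>x\<in>lvars \<D>. finite (ldom \<D> x)) \<and> finite (lcons \<D>) \<and>
     (\<forall>(x, \<alpha>, y)\<in>lcons \<D>. x \<in> lvars \<D> \<and> y \<in> lvars \<D> \<and> \<alpha> \<in> ldom \<D> y \<rightarrow> ldom \<D> x)"

definition discrete :: "('v, 'u) lc \<Rightarrow> bool" where
  "discrete \<D> \<longleftrightarrow> lcons \<D> = {}"

definition lc_solution :: "('v, 'u) lc \<Rightarrow> ('u, 'm) minion \<Rightarrow> ('v \<Rightarrow> 'm) \<Rightarrow> bool" where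
  "lc_solution \<D> R r \<longleftrightarrow> r \<in> (\<Pi>\<^sub>E x\<in>lvars \<D>. obj R (ldom \<D> x)) \<and>
     (\<forall>(x, \<alpha>, y)\<in>lcons \<D>. r x = mor R (ldom \<D> y) (ldom \<D> x) \<alpha> (r y))"

definition sigma_star :: "nat \<Rightarrow> (nat \<Rightarrow> nat) \<Rightarrow> 'c elt \<Rightarrow> 'c elt" where
  "sigma_star k \<sigma> u = Tup (map (\<lambda>i. comps u ! \<sigma> i) [0..<k])"

text \<open>Positions in tuples are counted from 0.\<close>

definition lc_pow :: "nat \<Rightarrow> ('v, 'c elt) lc \<Rightarrow> ('v list, 'c elt) lc" where
  "lc_pow k \<D> =
    (let cons' = lcons \<D> \<union> {(x, id, x) | x. x \<in> lvars \<D>} in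
     \<lparr> lvars = tuples k (lvars \<D>),
       ldom = (\<lambda>xs. set_prod (map (ldom \<D>) xs)),
       lcons =
         {(map (\<lambda>(x, \<alpha>, y). x) cs, prod_map (map (\<lambda>(x, \<alpha>, y). \<alpha>) cs), map (\<lambda>(x, \<alpha>, y). y) cs)
            | cs. cs \<in> tuples k cons'} \<union>
         {(map (\<lambda>i. xs ! \<sigma> i) [0..<k], sigma_star k \<sigma>, xs)
            | xs \<sigma>. xs \<in> tuples k (lvars \<D>) \<and> \<sigma> \<in> {..<k} \<rightarrow> {..<k}} \<rparr>)"

text \<open>
  Consistent families are closed under pointwise unions, so the union of all of them is the
  largest one.
\<close>

definition arc_consistent :: "('v, 'u) lc \<Rightarrow> ('v \<Rightarrow> 'u set) \<Rightarrow> bool" where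
  "arc_consistent \<D> D' \<longleftrightarrow> (\<forall>x\<in>lvars \<D>. D' x \<subseteq> ldom \<D> x) \<and>
     (\<forall>(x, \<alpha>, y)\<in>lcons \<D>. D' x = \<alpha> ` D' y)"

definition arc :: "('v, 'u) lc \<Rightarrow> ('v, 'u) lc" where
  "arc \<D> = \<D>\<lparr> ldom := (\<lambda>x. \<Union>D'\<in>{D'. arc_consistent \<D> D'}. D' x) \<rparr>"


lemma arc_consistent_arc: "arc_consistent \<D> (ldom (arc \<D>))"
proof -
  have "ldom (arc \<D>) x = \<alpha> ` ldom (arc \<D>) y" if c: "(x, \<alpha>, y) \<in> lcons \<D>" for x \<alpha> y
  proof -
    have "D' x = \<alpha> ` D' y" if "arc_consistent \<D> D'" for D'
      using that c unfolding arc_consistent_def by fast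
    then show ?thesis unfolding arc_def by (simp add: image_UN)
  qed
  moreover have "ldom (arc \<D>) x \<subseteq> ldom \<D> x" if "x \<in> lvars \<D>" for x
    using that by (auto simp: arc_def arc_consistent_def)
  ultimately show ?thesis unfolding arc_consistent_def[of \<D> "ldom (arc \<D>)"] by fast
qed

lemma arc_greatest:
  "arc_consistent \<D> D' \<Longrightarrow> D' x \<subseteq> ldom (arc \<D>) x"
  unfolding arc_def by auto

section \<open>The constructions \<open>lvl\<close> and \<open>\<omega>\<close>\<close>

text \<open>
  In a triple \<open>(\<E>, r, w)\<close> the three families are normalised to be undefined outside their
  index sets (the second one by definition of \<open>lc_solution\<close>), so that triples are
  equal as HOL values iff they are equal as mathematical objects.
\<close>

definition lvl_dom :: "('v, 'c elt) lc \<Rightarrow> 'c elt set \<Rightarrow> 'v list \<Rightarrow> 'c elt set" where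
  "lvl_dom \<E> C ys = set_prod (C # map (ldom \<E>) ys)"

definition lvl_map :: "nat \<Rightarrow> ('c elt \<Rightarrow> 'c elt) \<Rightarrow> 'c elt \<Rightarrow> 'c elt" where
  "lvl_map k \<alpha> = prod_map (\<alpha> # replicate (k - 1) id)"

type_synonym ('c, 'm) level =
  "('c elt, 'c elt) lc \<times> ('c elt list \<Rightarrow> 'm) \<times> ('c elt list \<Rightarrow> 'm)"

definition lvl :: "nat \<Rightarrow> ('c elt, 'm) minion \<Rightarrow> ('c elt, ('c, 'm) level) minion" where
  "lvl k R =
    \<lparr> obj = (\<lambda>C. {(\<E>, r, w).
         is_lc \<E> \<and> discrete \<E> \<and> ldom \<E> \<in> extensional (lvars \<E>) \<and>
         lc_solution (lc_pow k \<E>) R r \<and>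
         w \<in> (\<Pi>\<^sub>E ys\<in>tuples (k - 1) (lvars \<E>). obj R (lvl_dom \<E> C ys)) \<and>
         (\<exists>z\<in>lvars \<E>. \<exists>\<beta>\<in>ldom \<E> z \<rightarrow> C. \<forall>ys\<in>tuples (k - 1) (lvars \<E>).
            w ys = mor R (ldom (lc_pow k \<E>) (z # ys)) (lvl_dom \<E> C ys) (lvl_map k \<beta>) (r (z # ys)))}),
      mor = (\<lambda>C C' \<alpha> (\<E>, r, w).
         (\<E>, r, \<lambda>ys\<in>tuples (k - 1) (lvars \<E>).
            mor R (lvl_dom \<E> C ys) (lvl_dom \<E> C' ys) (lvl_map k \<alpha>) (w ys))) \<rparr>"

lemma lvl_map_Tup: "length es = k - 1 \<Longrightarrow> lvl_map k \<alpha> (Tup (c # es)) = Tup (\<alpha> c # es)"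
  by (auto simp: lvl_map_def prod_map_def intro!: nth_equalityI)

lemma listset_length: "es \<in> listset Ds \<Longrightarrow> length es = length Ds"
  by (induction Ds arbitrary: es) (auto simp: set_Cons_def)

lemma finite_listset: "(\<And>D. D \<in> set Ds \<Longrightarrow> finite D) \<Longrightarrow> finite (listset Ds)"
proof (induction Ds)
  case (Cons D Ds)
  have "listset (D # Ds) = (\<lambda>(d, ds). d # ds) ` (D \<times> listset Ds)" by (auto simp: set_Cons_def)
  then show ?case using Cons by simp
qed simp

lemma finite_set_prod: "(\<And>D. D \<in> set Ds \<Longrightarrow> finite D) \<Longrightarrow> finite (set_prod Ds)"
  by (simp add: set_prod_def finite_listset)

lemma lvl_dom_iff:
  "u \<in> lvl_dom \<E> C ys \<longleftrightarrow> (\<exists>c es. u = Tup (c # es) \<and> c \<in> C \<and> es \<in> listset (map (ldom \<E>) ys))"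
  by (auto simp: lvl_dom_def set_prod_def set_Cons_def)

lemma is_minion_lvl:
  assumes R: "is_minion R" and k: "k \<ge> 1"
  shows "is_minion (lvl k R)"
proof -
  have fin: "finite (lvl_dom \<E> C ys)"
    if "is_lc \<E>" "finite C" "ys \<in> tuples (k - 1) (lvars \<E>)" for \<E> :: "('a elt, 'a elt) lc" and C ys
    using that unfolding lvl_dom_def by (intro finite_set_prod) (auto simp: tuples_def is_lc_def)
  have map: "lvl_map k \<alpha> \<in> lvl_dom \<E> C ys \<rightarrow> lvl_dom \<E> C' ys"
    if "\<alpha> \<in> C \<rightarrow> C'" "ys \<in> tuples (k - 1) (lvars \<E>)"
    for \<E> :: "('a elt, 'a elt) lc" and \<alpha> C C' ys
    using that by (auto simp: lvl_dom_iff lvl_map_Tup listset_length tuples_def Pi_iff)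
  have comp: "lvl_map k (\<beta> \<circ> \<alpha>) u = (lvl_map k \<beta> \<circ> lvl_map k \<alpha>) u"
    if "u \<in> lvl_dom \<E> C ys" "ys \<in> tuples (k - 1) (lvars \<E>)"
    for \<E> :: "('a elt, 'a elt) lc" and \<alpha> \<beta> C ys u
    using that by (auto simp: lvl_dom_iff lvl_map_Tup listset_length tuples_def)
  have mor_comp: "mor R (lvl_dom \<E> C ys) (lvl_dom \<E> C'' ys) (lvl_map k (\<beta> \<circ> \<alpha>)) v =
      mor R (lvl_dom \<E> C' ys) (lvl_dom \<E> C'' ys) (lvl_map k \<beta>)
        (mor R (lvl_dom \<E> C ys) (lvl_dom \<E> C' ys) (lvl_map k \<alpha>) v)"
    if "is_lc \<E>" "finite C" "finite C'" "finite C''" "\<alpha> \<in> C \<rightarrow> C'" "\<beta> \<in> C' \<rightarrow> C''"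
      "ys \<in> tuples (k - 1) (lvars \<E>)" "v \<in> obj R (lvl_dom \<E> C ys)"
    for \<E> :: "('a elt, 'a elt) lc" and C C' C'' \<alpha> \<beta> ys v
  proof -
    have "\<beta> \<circ> \<alpha> \<in> C \<rightarrow> C''" using that by auto
    then have "mor R (lvl_dom \<E> C ys) (lvl_dom \<E> C'' ys) (lvl_map k (\<beta> \<circ> \<alpha>)) v =
        mor R (lvl_dom \<E> C ys) (lvl_dom \<E> C'' ys) (lvl_map k \<beta> \<circ> lvl_map k \<alpha>) v"
      using that comp by (intro minion_cong[OF R] fin map) auto
    also have "\<dots> = mor R (lvl_dom \<E> C' ys) (lvl_dom \<E> C'' ys) (lvl_map k \<beta>)
        (mor R (lvl_dom \<E> C ys) (lvl_dom \<E> C' ys) (lvl_map k \<alpha>) v)"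
      using that by (intro minion_comp[OF R] fin map)
    finally show ?thesis .
  qed
  show ?thesis
  proof (rule is_minionI, goal_cases)
    case (1 C C' \<alpha> p)
    obtain \<E> r w where p: "p = (\<E>, r, w)" by (cases p) auto
    let ?Y = "tuples (k - 1) (lvars \<E>)"
    let ?w = "\<lambda>ys\<in>?Y. mor R (lvl_dom \<E> C ys) (lvl_dom \<E> C' ys) (lvl_map k \<alpha>) (w ys)"
    have \<E>: "is_lc \<E>" "discrete \<E>" "ldom \<E> \<in> extensional (lvars \<E>)"
        "lc_solution (lc_pow k \<E>) R r" "w \<in> (\<Pi>\<^sub>E ys\<in>?Y. obj R (lvl_dom \<E> C ys))"
      using 1(4) by (auto simp: p lvl_def)
    obtain z \<beta> where z: "z \<in> lvars \<E>" "\<beta> \<in> ldom \<E> z \<rightarrow> C" "\<And>ys. ys \<in> ?Y \<Longrightarrow>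
        w ys = mor R (ldom (lc_pow k \<E>) (z # ys)) (lvl_dom \<E> C ys) (lvl_map k \<beta>) (r (z # ys))"
      using 1(4) unfolding p lvl_def by force
    have dz: "ldom (lc_pow k \<E>) (z # ys) = lvl_dom \<E> (ldom \<E> z) ys" for ys
      by (simp add: lc_pow_def Let_def lvl_dom_def)
    have "?w ys = mor R (ldom (lc_pow k \<E>) (z # ys)) (lvl_dom \<E> C' ys)
        (lvl_map k (\<alpha> \<circ> \<beta>)) (r (z # ys))" if ys: "ys \<in> ?Y" for ys
    proof -
      have "z # ys \<in> lvars (lc_pow k \<E>)"
        using ys z(1) k by (auto simp: lc_pow_def Let_def tuples_def)
      then have "r (z # ys) \<in> obj R (ldom (lc_pow k \<E>) (z # ys))"
        using \<E>(4) by (auto simp: lc_solution_def)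
      moreover have "finite (ldom \<E> z)" using \<E>(1) z(1) by (simp add: is_lc_def)
      ultimately have "mor R (lvl_dom \<E> (ldom \<E> z) ys) (lvl_dom \<E> C' ys) (lvl_map k (\<alpha> \<circ> \<beta>)) (r (z # ys))
          = mor R (lvl_dom \<E> C ys) (lvl_dom \<E> C' ys) (lvl_map k \<alpha>)
           (mor R (lvl_dom \<E> (ldom \<E> z) ys) (lvl_dom \<E> C ys) (lvl_map k \<beta>) (r (z # ys)))"
        using \<E>(1) z(1,2) 1(1-3) ys unfolding dz by (intro mor_comp)
      then show ?thesis using ys z(3)[OF ys] dz by simp
    qed
    moreover have "\<alpha> \<circ> \<beta> \<in> ldom \<E> z \<rightarrow> C'" using z(2) 1(3) by auto
    moreover have "?w \<in> (\<Pi>\<^sub>E ys\<in>?Y. obj R (lvl_dom \<E> C' ys))"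
      using \<E>(1,5) 1(1-3) by (intro restrict_PiE_iff[THEN iffD2] ballI minion_mor[OF R] fin map) auto
    ultimately have "\<exists>z\<in>lvars \<E>. \<exists>\<beta>\<in>ldom \<E> z \<rightarrow> C'. \<forall>ys\<in>?Y.
        ?w ys = mor R (ldom (lc_pow k \<E>) (z # ys)) (lvl_dom \<E> C' ys) (lvl_map k \<beta>) (r (z # ys))"
      and "?w \<in> (\<Pi>\<^sub>E ys\<in>?Y. obj R (lvl_dom \<E> C' ys))"
      using z(1) by blast+
    then show ?case using \<E>(1-4) by (simp add: p lvl_def)
  next
    case (2 C C' \<alpha> \<beta> p)
    obtain \<E> r w where p: "p = (\<E>, r, w)" by (cases p) auto
    have \<E>: "is_lc \<E>" "w \<in> (\<Pi>\<^sub>E ys\<in>tuples (k - 1) (lvars \<E>). obj R (lvl_dom \<E> C ys))"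
      using 2(5) by (auto simp: p lvl_def)
    have "mor R (lvl_dom \<E> C ys) (lvl_dom \<E> C' ys) (lvl_map k \<alpha>) (w ys) =
        mor R (lvl_dom \<E> C ys) (lvl_dom \<E> C' ys) (lvl_map k \<beta>) (w ys)"
      if ys: "ys \<in> tuples (k - 1) (lvars \<E>)" for ys
    proof (rule minion_cong[OF R])
      show "lvl_map k \<alpha> u = lvl_map k \<beta> u" if "u \<in> lvl_dom \<E> C ys" for u
        using that ys 2(4) by (auto simp: lvl_dom_iff lvl_map_Tup listset_length tuples_def)
    qed (use \<E> 2 ys fin map in auto)
    then show ?case by (simp add: p lvl_def cong: restrict_cong)
  next
    case (3 C p)
    obtain \<E> r w where p: "p = (\<E>, r, w)" by (cases p) auto
    have \<E>: "is_lc \<E>" "w \<in> (\<Pi>\<^sub>E ys\<in>tuples (k - 1) (lvars \<E>). obj R (lvl_dom \<E> C ys))"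
      using 3(2) by (auto simp: p lvl_def)
    have "mor R (lvl_dom \<E> C ys) (lvl_dom \<E> C ys) (lvl_map k id) (w ys) = w ys"
      if ys: "ys \<in> tuples (k - 1) (lvars \<E>)" for ys
    proof -
      have "mor R (lvl_dom \<E> C ys) (lvl_dom \<E> C ys) (lvl_map k id) (w ys) =
          mor R (lvl_dom \<E> C ys) (lvl_dom \<E> C ys) id (w ys)"
      proof (rule minion_cong[OF R])
        show "lvl_map k id u = id u" if "u \<in> lvl_dom \<E> C ys" for u
          using that ys by (auto simp: lvl_dom_iff lvl_map_Tup listset_length tuples_def)
        show "lvl_map k id \<in> lvl_dom \<E> C ys \<rightarrow> lvl_dom \<E> C ys" using ys by (intro map) auto
      qed (use \<E> 3 ys fin in auto)
      also have "\<dots> = w ys"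
        using \<E> 3(1) ys by (intro minion_id[OF R] fin) (blast dest: PiE_mem)+
      finally show ?thesis .
    qed
    then have "(\<lambda>ys\<in>tuples (k - 1) (lvars \<E>).
        mor R (lvl_dom \<E> C ys) (lvl_dom \<E> C ys) (lvl_map k id) (w ys)) = w"
      using \<E>(2) by (intro extensionalityI[of _ "tuples (k - 1) (lvars \<E>)"]) (auto simp: PiE_iff)
    then show ?case by (simp add: p lvl_def)
  next
    case (4 C C' C'' \<alpha> \<beta> p)
    obtain \<E> r w where p: "p = (\<E>, r, w)" by (cases p) auto
    have \<E>: "is_lc \<E>" "w \<in> (\<Pi>\<^sub>E ys\<in>tuples (k - 1) (lvars \<E>). obj R (lvl_dom \<E> C ys))"
      using 4(6) by (auto simp: p lvl_def)
    have "w ys \<in> obj R (lvl_dom \<E> C ys)" if "ys \<in> tuples (k - 1) (lvars \<E>)" for ys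
      using \<E>(2) that by auto
    then show ?case using mor_comp[OF \<E>(1) 4(1-5)] by (simp add: p lvl_def cong: restrict_cong)
  qed
qed

definition dummy :: "('u, 'm) minion \<Rightarrow> 'u set \<Rightarrow> 'u \<Rightarrow> 'm \<Rightarrow> bool" where
  "dummy R D d r \<longleftrightarrow> (\<exists>D'' \<alpha> r''. finite D'' \<and> \<alpha> \<in> D'' \<rightarrow> D \<and> r'' \<in> obj R D'' \<and>
     d \<notin> \<alpha> ` D'' \<and> r = mor R D'' D \<alpha> r'')"

definition dummy_pairs :: "('u, 'm) minion \<Rightarrow> 'u set \<Rightarrow> ('u set \<times> 'm) set" where
  "dummy_pairs R D = {(D', r). D' \<subseteq> D \<and> r \<in> obj R D \<and> (\<forall>d\<in>D - D'. dummy R D d r)}"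

text \<open>
  The pairs \<open>(D', r)\<close> with all elements of \<open>D - D'\<close> dummy in \<open>r\<close> are closed under the action
  of maps except possibly when \<open>D' = {}\<close>: if \<open>D\<close> has at least two elements, \<open>r\<close> can be constant
  in each single coordinate without coming from \<open>obj R {}\<close>, and then its image over a one-element
  set has no dummies.  For \<open>D' = {}\<close> we therefore require \<open>r\<close> to come from \<open>obj R {}\<close>.
  This is automatic whenever the pairs above do form a minion; see \<open>omega_obj_eq_dummy_pairs\<close>.
\<close>

definition omega :: "('u, 'm) minion \<Rightarrow> ('u, 'u set \<times> 'm) minion" where
  "omega R =
    \<lparr> obj = (\<lambda>D. {(D', r) \<in> dummy_pairs R D. D' = {} \<longrightarrow> r \<in> mor R {} D id ` obj R {}}),
      mor = (\<lambda>D E \<alpha> (D', r). (\<alpha> ` D', mor R D E \<alpha> r)) \<rparr>"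


lemma collapse_dummies:
  assumes R: "is_minion R" and D: "finite D" and r: "r \<in> obj R D" and e: "e \<in> D"
    and S: "S \<subseteq> D" "\<And>d. d \<in> S \<Longrightarrow> dummy R D d r"
  shows "mor R D D (\<lambda>u. if u \<in> S then e else u) r = r"
  using finite_subset[OF S(1) D] S
proof (induction S rule: finite_induct)
  case empty
  then show ?case using minion_id[OF R D r] by (simp add: id_def)
next
  case (insert d S)
  let ?g = "\<lambda>u. if u \<in> S then e else u" and ?h = "\<lambda>u. if u = d then e else u"
  obtain D2 \<alpha> r2 where *: "finite D2" "\<alpha> \<in> D2 \<rightarrow> D" "r2 \<in> obj R D2" "d \<notin> \<alpha> ` D2"
    "r = mor R D2 D \<alpha> r2"
    using insert.prems(2)[of d] unfolding dummy_def by blast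
  have "mor R D D ?h r = mor R D2 D (?h \<circ> \<alpha>) r2"
    unfolding *(5) using *(1-4) D e by (subst minion_comp[OF R]) auto
  also have "\<dots> = mor R D2 D \<alpha> r2"
    using *(1-4) D e by (intro minion_cong[OF R]) (auto simp: Pi_iff)
  finally have h: "mor R D D ?h r = r" using *(5) by simp
  have "(\<lambda>u. if u \<in> insert d S then e else u) = ?h \<circ> ?g" by (auto simp: fun_eq_iff)
  moreover have "mor R D D (?h \<circ> ?g) r = mor R D D ?h (mor R D D ?g r)"
    using e r D by (intro minion_comp[OF R]) auto
  ultimately show ?case using insert h by simp
qed

lemma omega_obj_eq_dummy_pairs:
  assumes R: "is_minion R"
    and closed: "\<And>D E \<alpha> D' r. finite D \<Longrightarrow> finite E \<Longrightarrow> \<alpha> \<in> D \<rightarrow> E \<Longrightarrow> (D', r) \<in> dummy_pairs R D \<Longrightarrow>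
      (\<alpha> ` D', mor R D E \<alpha> r) \<in> dummy_pairs R E"
    and D: "finite D"
  shows "obj (omega R) D = dummy_pairs R D"
proof -
  have "r \<in> mor R {} D id ` obj R {}" if r: "({}, r) \<in> dummy_pairs R D" for r
  proof (cases "D = {}")
    case True
    then have "r \<in> obj R {}" using r by (simp add: dummy_pairs_def)
    then show ?thesis
      unfolding True using minion_id[OF R, of "{}" r] by (metis finite.emptyI image_eqI)
  next
    case False
    then obtain e where e: "e \<in> D" by auto
    have rD: "r \<in> obj R D" and dum: "\<And>d. d \<in> D \<Longrightarrow> dummy R D d r"
      using r by (auto simp: dummy_pairs_def)
    have const: "mor R D D (\<lambda>u. if u \<in> D then e else u) r = r"
      using collapse_dummies[OF R D rD e subset_refl] dum by simp
    let ?c = "\<lambda>u. e"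
    define r1 where "r1 = mor R D {e} ?c r"
    have "mor R D D (?c \<circ> ?c) r = mor R {e} D ?c r1"
      unfolding r1_def using e rD D by (intro minion_comp[OF R]) auto
    moreover have "mor R D D (?c \<circ> ?c) r = mor R D D (\<lambda>u. if u \<in> D then e else u) r"
      using e rD D by (intro minion_cong[OF R]) auto
    ultimately have r1: "r = mor R {e} D ?c r1" using const by simp
    have "(?c ` {}, r1) \<in> dummy_pairs R {e}"
      unfolding r1_def using closed[OF D, of "{e}" ?c "{}" r] r by simp
    then have "dummy R {e} e r1" by (auto simp: dummy_pairs_def)
    then obtain D2 \<alpha> r2 where *: "finite D2" "\<alpha> \<in> D2 \<rightarrow> {e}" "r2 \<in> obj R D2" "e \<notin> \<alpha> ` D2"
        "r1 = mor R D2 {e} \<alpha> r2"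
      unfolding dummy_def by blast
    have "D2 = {}" using *(2,4) by (auto simp: Pi_iff image_iff)
    then have "r = mor R {} D (?c \<circ> \<alpha>) r2"
      unfolding r1 *(5) using *(3) D e by (subst minion_comp[OF R]) auto
    also have "\<dots> = mor R {} D id r2"
      using *(3) D \<open>D2 = {}\<close> by (intro minion_cong[OF R]) auto
    finally show ?thesis by (rule image_eqI) (use *(3) \<open>D2 = {}\<close> in simp)
  qed
  then show ?thesis unfolding omega_def minion.simps by blast
qed

lemma is_minion_omega:
  assumes R: "is_minion R"
  shows "is_minion (omega R)"
proof (rule is_minionI, goal_cases)
  case (1 D E \<alpha> p)
  obtain D' r where p: "p = (D', r)" by fastforce
  have D': "D' \<subseteq> D" and r: "r \<in> obj R D" and dum: "\<And>d. d \<in> D - D' \<Longrightarrow> dummy R D d r"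
    and emp: "D' = {} \<Longrightarrow> r \<in> mor R {} D id ` obj R {}"
    using 1(4) unfolding p omega_def dummy_pairs_def by auto
  have rE: "mor R D E \<alpha> r \<in> obj R E" using minion_mor[OF R 1(1-3) r] .
  have *: "\<exists>r''\<in>obj R {}. mor R D E \<alpha> r = mor R {} E id r''" if empty: "D' = {}"
  proof -
    obtain r'' where r'': "r'' \<in> obj R {}" "r = mor R {} D id r''" using emp[OF empty] by auto
    have "mor R D E \<alpha> r = mor R {} E (\<alpha> \<circ> id) r''"
      unfolding r''(2) using r''(1) 1(1-3) by (subst minion_comp[OF R]) auto
    also have "\<dots> = mor R {} E id r''"
      using r''(1) 1(1-3) by (intro minion_cong[OF R]) auto
    finally show ?thesis using r''(1) by (intro bexI)
  qed
  have "dummy R E e (mor R D E \<alpha> r)" if e: "e \<in> E - \<alpha> ` D'" for e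
  proof (cases "D' = {}")
    case True
    then obtain r'' where "r'' \<in> obj R {}" "mor R D E \<alpha> r = mor R {} E id r''" using * by auto
    then show ?thesis unfolding dummy_def
      by (intro exI[of _ "{}"] exI[of _ id] exI[of _ r'']) simp
  next
    case False
    then obtain d0 where d0: "d0 \<in> D'" by auto
    let ?S = "{d \<in> D. \<alpha> d = e}"
    let ?g = "\<lambda>u. if u \<in> ?S then d0 else u"
    have g: "?g \<in> D \<rightarrow> D" using d0 D' by auto
    have "mor R D D ?g r = r"
    proof (rule collapse_dummies[OF R 1(1) r])
      show "d0 \<in> D" using d0 D' by auto
      show "?S \<subseteq> D" by auto
      show "dummy R D d r" if "d \<in> ?S" for d
        using that e by (intro dum) auto
    qed
    then have "mor R D E \<alpha> r = mor R D E (\<alpha> \<circ> ?g) r"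
      using minion_comp[OF R 1(1) 1(1) 1(2) g 1(3) r] by simp
    moreover have "\<alpha> \<circ> ?g \<in> D \<rightarrow> E"
      using g 1(3) by (simp add: Pi_iff)
    moreover have "e \<notin> (\<alpha> \<circ> ?g) ` D" using e d0 by (auto split: if_splits)
    ultimately show ?thesis unfolding dummy_def using 1(1) r
      by (intro exI[of _ D] exI[of _ "\<alpha> \<circ> ?g"] exI[of _ r]) simp
  qed
  moreover have "\<alpha> ` D' \<subseteq> E" using D' 1(3) by auto
  ultimately show ?case using rE * unfolding p omega_def dummy_pairs_def by auto
next
  case (2 D E \<alpha> \<beta> p)
  obtain D' r where p: "p = (D', r)" by fastforce
  have "D' \<subseteq> D" "r \<in> obj R D" using 2(5) unfolding p omega_def dummy_pairs_def by auto
  moreover from this have "mor R D E \<alpha> r = mor R D E \<beta> r"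
    using 2 by (intro minion_cong[OF R]) auto
  moreover have "\<alpha> ` D' = \<beta> ` D'" using 2(4) \<open>D' \<subseteq> D\<close> by (intro image_cong) auto
  ultimately show ?case by (simp add: p omega_def)
next
  case (3 D p)
  then show ?case using minion_id[OF R 3(1)] by (auto simp: omega_def dummy_pairs_def)
next
  case (4 D E F \<alpha> \<beta> p)
  then show ?case using minion_comp[OF R 4(1-5)]
    by (auto simp: omega_def dummy_pairs_def image_comp)
qed

section \<open>Structures and promise CSPs\<close>

record 's signat =
  syms :: "'s set"
  ar :: "'s \<Rightarrow> nat"

record ('s, 'a) rel_struct =
  universe :: "'a set"
  rel :: "'s \<Rightarrow> 'a list set"

definition is_struct :: "'s signat \<Rightarrow> ('s, 'a) rel_struct \<Rightarrow> bool" where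
  "is_struct \<Sigma> \<A> \<longleftrightarrow> finite (universe \<A>) \<and> (\<forall>R\<in>syms \<Sigma>. rel \<A> R \<subseteq> tuples (ar \<Sigma> R) (universe \<A>))"

definition struct_hom ::
    "'s signat \<Rightarrow> ('s, 'a) rel_struct \<Rightarrow> ('s, 'b) rel_struct \<Rightarrow> ('a \<Rightarrow> 'b) \<Rightarrow> bool" where
  "struct_hom \<Sigma> \<A> \<B> f \<longleftrightarrow> f \<in> universe \<A> \<rightarrow> universe \<B> \<and>
     (\<forall>R\<in>syms \<Sigma>. \<forall>t\<in>rel \<A> R. map f t \<in> rel \<B> R)"

definition pcsp_template ::
    "'s signat \<Rightarrow> ('s, 'a) rel_struct \<Rightarrow> ('s, 'b) rel_struct \<Rightarrow> bool" where
  "pcsp_template \<Sigma> \<A> \<B> \<longleftrightarrow> finite (syms \<Sigma>) \<and> is_struct \<Sigma> \<A> \<and> is_struct \<Sigma> \<B> \<and>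
     (\<exists>h. struct_hom \<Sigma> \<A> \<B> h)"

definition struct_pow ::
    "'s signat \<Rightarrow> ('s, 'a) rel_struct \<Rightarrow> 'u set \<Rightarrow> ('s, 'u \<Rightarrow> 'a) rel_struct" where
  "struct_pow \<Sigma> \<A> D =
    \<lparr> universe = D \<rightarrow>\<^sub>E universe \<A>,
      rel = (\<lambda>R. {t \<in> tuples (ar \<Sigma> R) (D \<rightarrow>\<^sub>E universe \<A>). \<forall>d\<in>D. map (\<lambda>a. a d) t \<in> rel \<A> R}) \<rparr>"

definition Pol ::
    "'s signat \<Rightarrow> ('s, 'a) rel_struct \<Rightarrow> ('s, 'b) rel_struct \<Rightarrow> ('u, ('u \<Rightarrow> 'a) \<Rightarrow> 'b) minion" where
  "Pol \<Sigma> \<A> \<B> =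
    \<lparr> obj = (\<lambda>D. {f \<in> extensional (D \<rightarrow>\<^sub>E universe \<A>). struct_hom \<Sigma> (struct_pow \<Sigma> \<A> D) \<B> f}),
      mor = (\<lambda>D E \<alpha> f. \<lambda>a\<in>E \<rightarrow>\<^sub>E universe \<A>. f (restrict (a \<circ> \<alpha>) D)) \<rparr>"

lemma is_minion_Pol:
  "is_minion (Pol \<Sigma> (\<A> :: ('s, 'a) rel_struct) \<B> :: ('u, ('u \<Rightarrow> 'a) \<Rightarrow> 'b) minion)"
proof (rule is_minionI, goal_cases)
  case (1 D E \<alpha> f)
  let ?h = "\<lambda>a. restrict (a \<circ> \<alpha>) D"
  have res: "?h a \<in> D \<rightarrow>\<^sub>E universe \<A>" if "a \<in> E \<rightarrow>\<^sub>E universe \<A>" for a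
    using that 1(3) by (auto simp: PiE_iff Pi_iff)
  have f: "f \<in> (D \<rightarrow>\<^sub>E universe \<A>) \<rightarrow> universe \<B>"
    "\<And>R t. R \<in> syms \<Sigma> \<Longrightarrow> t \<in> rel (struct_pow \<Sigma> \<A> D) R \<Longrightarrow> map f t \<in> rel \<B> R"
    using 1(4) by (auto simp: Pol_def struct_hom_def struct_pow_def)
  have "map (\<lambda>a\<in>E \<rightarrow>\<^sub>E universe \<A>. f (?h a)) t \<in> rel \<B> R"
    if R: "R \<in> syms \<Sigma>" and t: "t \<in> rel (struct_pow \<Sigma> \<A> E) R" for R t
  proof -
    have t': "set t \<subseteq> E \<rightarrow>\<^sub>E universe \<A>" using t by (auto simp: struct_pow_def tuples_def)
    have "set (map ?h t) \<subseteq> D \<rightarrow>\<^sub>E universe \<A>" using t' res by fastforce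
    moreover have "map (\<lambda>a. a d) (map ?h t) \<in> rel \<A> R" if "d \<in> D" for d
    proof -
      have "map (\<lambda>a. a d) (map ?h t) = map (\<lambda>a. a (\<alpha> d)) t" using that by simp
      moreover have "map (\<lambda>a. a (\<alpha> d)) t \<in> rel \<A> R"
        using t that 1(3) by (auto simp: struct_pow_def)
      ultimately show ?thesis by metis
    qed
    ultimately have "map ?h t \<in> rel (struct_pow \<Sigma> \<A> D) R"
      using t by (simp add: struct_pow_def tuples_def)
    then have "map f (map ?h t) \<in> rel \<B> R" using f(2) R by blast
    moreover have "map (\<lambda>a\<in>E \<rightarrow>\<^sub>E universe \<A>. f (?h a)) t = map f (map ?h t)"
      using t' by (auto simp: subset_iff)
    ultimately show ?thesis by metis
  qed
  moreover have "(\<lambda>a\<in>E \<rightarrow>\<^sub>E universe \<A>. f (?h a)) \<in> (E \<rightarrow>\<^sub>E universe \<A>) \<rightarrow> universe \<B>"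
    using f(1) res by (simp add: Pi_iff)
  ultimately show ?case by (simp add: Pol_def struct_hom_def struct_pow_def)
next
  case (2 D E \<alpha> \<beta> f)
  then have "restrict (a \<circ> \<alpha>) D = restrict (a \<circ> \<beta>) D" for a :: "'u \<Rightarrow> 'a"
    by (intro restrict_ext) simp
  then show ?case by (simp add: Pol_def)
next
  case (3 D f)
  then have "f \<in> extensional (D \<rightarrow>\<^sub>E universe \<A>)" by (simp add: Pol_def)
  then show ?case by (intro extensionalityI[of _ "D \<rightarrow>\<^sub>E universe \<A>"]) (simp_all add: Pol_def PiE_restrict)
next
  case (4 D E F \<alpha> \<beta> f)
  have "restrict (a \<circ> \<beta>) E \<in> E \<rightarrow>\<^sub>E universe \<A>" if "a \<in> F \<rightarrow>\<^sub>E universe \<A>" for a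
    using that 4(5) by (auto simp: PiE_iff Pi_iff)
  moreover have "restrict (restrict (a \<circ> \<beta>) E \<circ> \<alpha>) D = restrict (a \<circ> (\<beta> \<circ> \<alpha>)) D" for a :: "'u \<Rightarrow> 'a"
    using 4(4) by (intro restrict_ext) auto
  ultimately show ?case unfolding Pol_def minion.simps by (intro restrict_ext) simp
qed

text \<open>
  An instance carries its finite set of variables, so that variables occurring in no constraint
  are possible, as they are for the instances produced by \<open>csp\<close>.
\<close>

record ('x, 's) pcsp_inst =
  ivars :: "'x set"
  icons :: "('s \<times> 'x list) list"

definition is_inst :: "'s signat \<Rightarrow> ('x, 's) pcsp_inst \<Rightarrow> bool" where
  "is_inst \<Sigma> \<I> \<longleftrightarrow> finite (ivars \<I>) \<and>
     (\<forall>(R, xs)\<in>set (icons \<I>). R \<in> syms \<Sigma> \<and> xs \<in> tuples (ar \<Sigma> R) (ivars \<I>))"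

definition solvable_in :: "('x, 's) pcsp_inst \<Rightarrow> ('s, 'a) rel_struct \<Rightarrow> bool" where
  "solvable_in \<I> \<A> \<longleftrightarrow>
     (\<exists>s\<in>ivars \<I> \<rightarrow> universe \<A>. \<forall>(R, xs)\<in>set (icons \<I>). map s xs \<in> rel \<A> R)"


section \<open>The reductions\<close>

text \<open>\<open>Inl x\<close> stands for the variable \<open>x\<close> of the instance, \<open>Inr j\<close> for its \<open>j\<close>-th constraint.\<close>

definition lc_of ::
    "('s, 'c) rel_struct \<Rightarrow> ('x, 's) pcsp_inst \<Rightarrow> ('x + nat, 'c elt) lc" where
  "lc_of \<A> \<I> =
    \<lparr> lvars = Inl ` ivars \<I> \<union> Inr ` {..<length (icons \<I>)},
      ldom = case_sum (\<lambda>x. Atom ` universe \<A>)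
                     (\<lambda>j. (\<lambda>t. Tup (map Atom t)) ` rel \<A> (fst (icons \<I> ! j))),
      lcons = {(Inl (snd (icons \<I> ! j) ! i), \<lambda>u. comps u ! i, Inr j) | i j.
                j < length (icons \<I>) \<and> i < length (snd (icons \<I> ! j))} \<rparr>"

definition csp_pairs ::
    "('s, 'a) rel_struct \<Rightarrow> ('v, 'u) lc \<Rightarrow> ('v \<times> ('u \<Rightarrow> 'a)) set" where
  "csp_pairs \<A> \<D> = (SIGMA x:lvars \<D>. ldom \<D> x \<rightarrow>\<^sub>E universe \<A>)"

definition csp_step ::
    "('s, 'a) rel_struct \<Rightarrow> ('v, 'u) lc \<Rightarrow> ('v \<times> ('u \<Rightarrow> 'a)) rel" where
  "csp_step \<A> \<D> = {((x, a), (y, restrict (a \<circ> \<alpha>) (ldom \<D> y))) | x \<alpha> y a.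
     (x, \<alpha>, y) \<in> lcons \<D> \<and> a \<in> ldom \<D> x \<rightarrow>\<^sub>E universe \<A>}"

definition csp_equiv ::
    "('s, 'a) rel_struct \<Rightarrow> ('v, 'u) lc \<Rightarrow> ('v \<times> ('u \<Rightarrow> 'a)) rel" where
  "csp_equiv \<A> \<D> = (csp_step \<A> \<D> \<union> (csp_step \<A> \<D>)\<inverse>)\<^sup>*"

definition csp_cons ::
    "'s signat \<Rightarrow> ('s, 'a) rel_struct \<Rightarrow> ('v, 'u) lc \<Rightarrow> ('s \<times> ('v \<times> ('u \<Rightarrow> 'a)) set list) set" where
  "csp_cons \<Sigma> \<A> \<D> = {(R, map (\<lambda>a. csp_equiv \<A> \<D> `` {(x, a)}) as) | R x as.
     R \<in> syms \<Sigma> \<and> x \<in> lvars \<D> \<and> as \<in> tuples (ar \<Sigma> R) (ldom \<D> x \<rightarrow>\<^sub>E universe \<A>) \<and>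
     (\<forall>d\<in>ldom \<D> x. map (\<lambda>a. a d) as \<in> rel \<A> R)}"

text \<open>
  The order in which the constraints are listed is immaterial.
  The set \<open>csp_cons \<Sigma> \<A> \<D>\<close> is finite (\<open>finite_csp_cons\<close> below), so such a list exists.
\<close>

definition csp ::
    "'s signat \<Rightarrow> ('s, 'a) rel_struct \<Rightarrow> ('v, 'u) lc \<Rightarrow> (('v \<times> ('u \<Rightarrow> 'a)) set, 's) pcsp_inst" where
  "csp \<Sigma> \<A> \<D> =
    \<lparr> ivars = csp_pairs \<A> \<D> // csp_equiv \<A> \<D>,
      icons = (SOME cs. set cs = csp_cons \<Sigma> \<A> \<D> \<and> distinct cs) \<rparr>"

lemma finite_tuples: "finite A \<Longrightarrow> finite (tuples k A)"
  using finite_lists_length_eq[of A k] by (simp add: tuples_def conj_commute)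

lemma finite_csp_cons:
  assumes "pcsp_template \<Sigma> \<A> \<B>" "finite (lvars \<D>)" "\<And>x. x \<in> lvars \<D> \<Longrightarrow> finite (ldom \<D> x)"
  shows "finite (csp_cons \<Sigma> \<A> \<D>)"
proof -
  have fin: "finite (syms \<Sigma>)" "finite (universe \<A>)"
    using assms(1) by (auto simp: pcsp_template_def is_struct_def)
  have "csp_cons \<Sigma> \<A> \<D> \<subseteq> (\<Union>R\<in>syms \<Sigma>. \<Union>x\<in>lvars \<D>.
      (\<lambda>as. (R, map (\<lambda>a. csp_equiv \<A> \<D> `` {(x, a)}) as)) ` tuples (ar \<Sigma> R) (ldom \<D> x \<rightarrow>\<^sub>E universe \<A>))"
    by (auto simp: csp_cons_def)
  moreover have "finite \<dots>"
    using fin assms(2,3) by (intro finite_UN_I finite_imageI finite_tuples finite_PiE) auto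
  ultimately show ?thesis by (rule finite_subset)
qed

lemma set_icons_csp:
  assumes "finite (csp_cons \<Sigma> \<A> \<D>)"
  shows "set (icons (csp \<Sigma> \<A> \<D>)) = csp_cons \<Sigma> \<A> \<D>"
  using someI_ex[OF finite_distinct_list[OF assms]] by (simp add: csp_def)

definition k_consistency ::
    "nat \<Rightarrow> 's signat \<Rightarrow> ('s, 'a) rel_struct \<Rightarrow> ('t, 'c) rel_struct \<Rightarrow> ('x, 't) pcsp_inst \<Rightarrow>
     ((('x + nat) list \<times> ('c elt \<Rightarrow> 'a)) set, 's) pcsp_inst" where
  "k_consistency k \<Sigma> \<A> \<A>' \<I> = csp \<Sigma> \<A> (arc (lc_pow k (lc_of \<A>' \<I>)))"

text \<open>Since an instance has only finitely many variables, they can be taken to be natural numbers.\<close>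

definition reduces_via_k_consistency ::
    "nat \<Rightarrow> 't signat \<Rightarrow> ('t, 'c) rel_struct \<Rightarrow> ('t, 'd) rel_struct \<Rightarrow>
     's signat \<Rightarrow> ('s, 'a) rel_struct \<Rightarrow> ('s, 'b) rel_struct \<Rightarrow> bool" where
  "reduces_via_k_consistency k \<Sigma>' \<A>' \<B>' \<Sigma> \<A> \<B> \<longleftrightarrow>
     (\<forall>\<I> :: (nat, 't) pcsp_inst. is_inst \<Sigma>' \<I> \<longrightarrow>
        (solvable_in \<I> \<A>' \<longrightarrow> solvable_in (k_consistency k \<Sigma> \<A> \<A>' \<I>) \<A>) \<and>
        (solvable_in (k_consistency k \<Sigma> \<A> \<A>' \<I>) \<B> \<longrightarrow> solvable_in \<I> \<B>'))"

end

theory Submission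
  imports Defs
begin

text \<open>
  An instance \<open>\<I>\<^sup>\<sharp>\<close> is solvable in \<open>\<B>\<close> iff \<open>pow\<^sub>k lc(\<I>)\<close> is solvable in \<open>\<omega>\<M>\<close>: a solution in \<open>\<omega>\<M>\<close> marks
  an arc-consistent family of subdomains on which the polymorphisms live. From a solution of
  \<open>pow\<^sub>k \<D>\<close> in a minion \<open>\<R>\<close> one reads off a solution of \<open>\<D>\<close> in \<open>lvl\<^sub>k \<R>\<close>, all of whose elements share
  one pair \<open>(\<E>, r)\<close>. Conversely, if the elements \<open>(\<E>, r, w\<^sub>x)\<close> solve \<open>\<D>\<close>, with \<open>w\<^sub>x\<close> induced by
  \<open>z\<^sub>x\<close> and \<open>\<beta>\<^sub>x\<close>, then the images of \<open>r\<close> at \<open>z\<^sub>x\<^sub>1 \<dots> z\<^sub>x\<^sub>k\<close> under \<open>\<beta>\<^sub>x\<^sub>1 \<times> \<cdots> \<times> \<beta>\<^sub>x\<^sub>k\<close> solve \<open>pow\<^sub>k \<D>\<close>: a constraint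
  \<open>x = \<alpha>(y)\<close> allows exchanging \<open>(z\<^sub>x, \<beta>\<^sub>x)\<close> for \<open>(z\<^sub>y, \<alpha> \<circ> \<beta>\<^sub>y)\<close> in the first coordinate, and by the
  reindexing constraints in any other one. For fixed \<open>(\<E>, r)\<close> the level has only finitely many
  elements over each finite set, so that its free structure is a finite instance, and no
  compactness argument is needed to obtain a homomorphism to \<open>\<M>'\<close> from the reduction.
\<close>


section \<open>Label cover instances, arc consistency and \<open>omega\<close>\<close>

text \<open>Makes no demand on the size of the constraint set, so that it passes to
  \<open>arc\<close> and \<open>lc_pow\<close> without counting constraints.\<close>

definition lc_wf :: "('v, 'u) lc \<Rightarrow> bool" where
  "lc_wf \<D> \<longleftrightarrow> finite (lvars \<D>) \<and> (\<forall>x\<in>lvars \<D>. finite (ldom \<D> x)) \<and>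
     (\<forall>(x, \<alpha>, y)\<in>lcons \<D>. x \<in> lvars \<D> \<and> y \<in> lvars \<D> \<and> \<alpha> \<in> ldom \<D> y \<rightarrow> ldom \<D> x)"

lemma
  assumes "lc_wf \<D>"
  shows lc_wf_finite: "x \<in> lvars \<D> \<Longrightarrow> finite (ldom \<D> x)"
    and lc_wf_cons: "(x, \<alpha>, y) \<in> lcons \<D> \<Longrightarrow> x \<in> lvars \<D> \<and> y \<in> lvars \<D> \<and> \<alpha> \<in> ldom \<D> y \<rightarrow> ldom \<D> x"
  using assms unfolding lc_wf_def by blast+

lemma lc_solutionI:
  assumes "\<And>x. x \<in> lvars \<D> \<Longrightarrow> r x \<in> obj R (ldom \<D> x)" "r \<in> extensional (lvars \<D>)"
    and "\<And>x \<alpha> y. (x, \<alpha>, y) \<in> lcons \<D> \<Longrightarrow> r x = mor R (ldom \<D> y) (ldom \<D> x) \<alpha> (r y)"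
  shows "lc_solution \<D> R r"
  using assms unfolding lc_solution_def by (auto simp: PiE_iff)

lemma
  assumes "lc_solution \<D> R r"
  shows lc_solution_obj: "x \<in> lvars \<D> \<Longrightarrow> r x \<in> obj R (ldom \<D> x)"
    and lc_solution_cons: "(x, \<alpha>, y) \<in> lcons \<D> \<Longrightarrow> r x = mor R (ldom \<D> y) (ldom \<D> x) \<alpha> (r y)"
  using assms unfolding lc_solution_def by (auto simp: PiE_iff)

lemma lc_solution_hom:
  assumes \<xi>: "minion_hom \<xi> R S" and wf: "lc_wf \<D>" and r: "lc_solution \<D> R r"
  shows "lc_solution \<D> S (\<lambda>x\<in>lvars \<D>. \<xi> (ldom \<D> x) (r x))"
proof (rule lc_solutionI)
  show "(\<lambda>x\<in>lvars \<D>. \<xi> (ldom \<D> x) (r x)) x \<in> obj S (ldom \<D> x)" if "x \<in> lvars \<D>" for x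
    using that \<xi> lc_solution_obj[OF r that] lc_wf_finite[OF wf that] by (auto simp: minion_hom_def)
next
  fix x \<alpha> y assume c: "(x, \<alpha>, y) \<in> lcons \<D>"
  note wfc = lc_wf_cons[OF wf c]
  have "\<xi> (ldom \<D> x) (mor R (ldom \<D> y) (ldom \<D> x) \<alpha> (r y)) =
      mor S (ldom \<D> y) (ldom \<D> x) \<alpha> (\<xi> (ldom \<D> y) (r y))"
    using \<xi> wfc lc_wf_finite[OF wf, of x] lc_wf_finite[OF wf, of y] lc_solution_obj[OF r, of y]
    by (simp add: minion_hom_def)
  then show "(\<lambda>x\<in>lvars \<D>. \<xi> (ldom \<D> x) (r x)) x =
      mor S (ldom \<D> y) (ldom \<D> x) \<alpha> ((\<lambda>x\<in>lvars \<D>. \<xi> (ldom \<D> x) (r x)) y)"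
    using wfc lc_solution_cons[OF r c] by simp
qed simp

section \<open>Arc-consistent restrictions and solutions in \<open>omega R\<close>\<close>

lemma arc_simps [simp]: "lvars (arc \<D>) = lvars \<D>" "lcons (arc \<D>) = lcons \<D>"
  by (simp_all add: arc_def)

lemma ldom_arc_subset: "x \<in> lvars \<D> \<Longrightarrow> ldom (arc \<D>) x \<subseteq> ldom \<D> x"
  using arc_consistent_arc[of \<D>] by (simp add: arc_consistent_def)

lemma ldom_arc_image: "(x, \<alpha>, y) \<in> lcons \<D> \<Longrightarrow> ldom (arc \<D>) x = \<alpha> ` ldom (arc \<D>) y"
  using arc_consistent_arc[of \<D>] by (auto simp: arc_consistent_def)

lemma lc_wf_arc:
  assumes "lc_wf \<D>"
  shows "lc_wf (arc \<D>)"
  unfolding lc_wf_def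
proof (intro conjI ballI)
  show "finite (lvars (arc \<D>))" using assms by (simp add: lc_wf_def)
  show "finite (ldom (arc \<D>) x)" if "x \<in> lvars (arc \<D>)" for x
    using that lc_wf_finite[OF assms] finite_subset[OF ldom_arc_subset[of x \<D>]] by simp
  show "case c of (x, \<alpha>, y) \<Rightarrow> x \<in> lvars (arc \<D>) \<and> y \<in> lvars (arc \<D>) \<and>
      \<alpha> \<in> ldom (arc \<D>) y \<rightarrow> ldom (arc \<D>) x" if carc: "c \<in> lcons (arc \<D>)" for c
  proof -
    obtain x \<alpha> y where c: "c = (x, \<alpha>, y)" "(x, \<alpha>, y) \<in> lcons \<D>" using carc by (cases c) simp
    show ?thesis using lc_wf_cons[OF assms c(2)] ldom_arc_image[OF c(2)] by (simp add: c(1))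
  qed
qed

text \<open>Each value is extended along the inclusion of the arc-consistent subdomain and marked by
  that subdomain. Elements outside it are dummies because the extension comes from a map that misses
  them, and the marks match because constraint maps send arc-consistent subdomains onto each
  other.\<close>

lemma lc_solution_arc_to_omega:
  assumes R: "is_minion R" and wf: "lc_wf \<D>" and r: "lc_solution (arc \<D>) R r"
  shows "lc_solution \<D> (omega R)
    (\<lambda>x\<in>lvars \<D>. (ldom (arc \<D>) x, mor R (ldom (arc \<D>) x) (ldom \<D> x) id (r x)))"
proof (rule lc_solutionI)
  fix x assume x: "x \<in> lvars \<D>"
  let ?E = "ldom (arc \<D>) x" and ?D = "ldom \<D> x"
  have sub: "?E \<subseteq> ?D" by (rule ldom_arc_subset[OF x])
  have fin: "finite ?D" "finite ?E" using lc_wf_finite[OF wf x] finite_subset sub by blast+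
  have rx: "r x \<in> obj R ?E" using lc_solution_obj[OF r] x by simp
  have "mor R ?E ?D id (r x) \<in> obj R ?D" by (rule minion_mor[OF R fin(2,1) _ rx]) (use sub in auto)
  moreover have "dummy R ?D d (mor R ?E ?D id (r x))" if "d \<in> ?D - ?E" for d
    unfolding dummy_def using that fin sub rx by (intro exI[of _ ?E] exI[of _ id] exI[of _ "r x"]) auto
  \<comment> \<open>This is the additional clause of \<open>omega\<close> for an empty mark; here
    the preimage over the empty set is \<open>r x\<close> itself.\<close>
  moreover have "mor R ?E ?D id (r x) \<in> mor R {} ?D id ` obj R {}" if "?E = {}"
    using rx that by simp
  ultimately show "(\<lambda>x\<in>lvars \<D>. (ldom (arc \<D>) x, mor R (ldom (arc \<D>) x) (ldom \<D> x) id (r x))) x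
      \<in> obj (omega R) ?D"
    using sub x by (simp add: omega_def dummy_pairs_def)
next
  fix x \<alpha> y assume c: "(x, \<alpha>, y) \<in> lcons \<D>"
  note wfc = lc_wf_cons[OF wf c]
  let ?E = "ldom (arc \<D>)" and ?D = "ldom \<D>"
  have sub: "?E x \<subseteq> ?D x" "?E y \<subseteq> ?D y" using ldom_arc_subset[of x \<D>] ldom_arc_subset[of y \<D>] wfc by simp_all
  have fin: "finite (?D x)" "finite (?E x)" "finite (?D y)" "finite (?E y)"
    using lc_wf_finite[OF wf] lc_wf_finite[OF lc_wf_arc[OF wf]] wfc by simp_all
  have ry: "r y \<in> obj R (?E y)" using lc_solution_obj[OF r] wfc by simp
  have im: "?E x = \<alpha> ` ?E y" by (rule ldom_arc_image[OF c])
  have "mor R (?E x) (?D x) id (r x) = mor R (?E x) (?D x) id (mor R (?E y) (?E x) \<alpha> (r y))"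
    using lc_solution_cons[OF r, of x \<alpha> y] c by simp
  also have "\<dots> = mor R (?E y) (?D x) (id \<circ> \<alpha>) (r y)"
    using sub im by (intro minion_comp[OF R fin(4) fin(2) fin(1) _ _ ry, symmetric]) auto
  also have "\<dots> = mor R (?E y) (?D x) (\<alpha> \<circ> id) (r y)" by simp
  also have "\<dots> = mor R (?D y) (?D x) \<alpha> (mor R (?E y) (?D y) id (r y))"
    using sub wfc by (intro minion_comp[OF R fin(4) fin(3) fin(1) _ _ ry]) auto
  finally show "(\<lambda>x\<in>lvars \<D>. (?E x, mor R (?E x) (?D x) id (r x))) x =
      mor (omega R) (?D y) (?D x) \<alpha> ((\<lambda>x\<in>lvars \<D>. (?E x, mor R (?E x) (?D x) id (r x))) y)"
    using wfc im by (simp add: omega_def)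
qed simp

text \<open>Collapsing everything outside \<open>D'\<close> to one point of \<open>D'\<close> fixes
  \<open>r\<close> by \<open>collapse_dummies\<close>, and this collapsing map already lands in
  \<open>E\<close>. An empty \<open>D'\<close> offers no such point; then the clause of
  \<open>omega\<close> for empty marks supplies a preimage over the empty set, which is pushed to
  \<open>E\<close>.\<close>

lemma omega_factor:
  assumes R: "is_minion R" and D: "finite D" and p: "(D', r) \<in> obj (omega R) D"
    and E: "D' \<subseteq> E" "E \<subseteq> D"
  obtains s where "s \<in> obj R E" "mor R E D id s = r"
proof -
  have D': "D' \<subseteq> D" and r: "r \<in> obj R D" and dum: "\<And>d. d \<in> D - D' \<Longrightarrow> dummy R D d r"
    and emp: "D' = {} \<Longrightarrow> r \<in> mor R {} D id ` obj R {}"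
    using p by (auto simp: omega_def dummy_pairs_def)
  have finE: "finite E" using E D finite_subset by blast
  show thesis
  proof (cases "D' = {}")
    case True
    then obtain t where t: "t \<in> obj R {}" "r = mor R {} D id t" using emp by auto
    show thesis
    proof (rule that)
      show "mor R {} E id t \<in> obj R E" using t finE by (intro minion_mor[OF R]) auto
      have "mor R {} D (id \<circ> id) t = mor R E D id (mor R {} E id t)"
        using t finE D E by (intro minion_comp[OF R]) auto
      then show "mor R E D id (mor R {} E id t) = r" using t by simp
    qed
  next
    case False
    then obtain e where e: "e \<in> D'" by auto
    let ?g = "\<lambda>u. if u \<in> D - D' then e else u"
    have g: "?g \<in> D \<rightarrow> E" using e D' E by auto
    have eq: "mor R D D ?g r = r"
      using e D' dum by (intro collapse_dummies[OF R D r]) auto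
    show thesis
    proof (rule that)
      show "mor R D E ?g r \<in> obj R E" by (rule minion_mor[OF R D finE g r])
      have "mor R D D (id \<circ> ?g) r = mor R E D id (mor R D E ?g r)"
        using E by (intro minion_comp[OF R D finE D g _ r]) auto
      then show "mor R E D id (mor R D E ?g r) = r" using eq by simp
    qed
  qed
qed

text \<open>The inclusion of a nonempty set has a retraction, which functoriality turns into a left
  inverse.\<close>

lemma mor_inclusion_inj:
  assumes R: "is_minion R" and D: "finite D" and E: "E \<subseteq> D" "E \<noteq> {}"
    and st: "s \<in> obj R E" "t \<in> obj R E" "mor R E D id s = mor R E D id t"
  shows "s = t"
proof -
  obtain e where e: "e \<in> E" using E by auto
  have finE: "finite E" using E D finite_subset by blast
  let ?g = "\<lambda>u. if u \<in> E then u else e"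
  have retract: "mor R D E ?g (mor R E D id u) = u" if u: "u \<in> obj R E" for u
  proof -
    have "mor R D E ?g (mor R E D id u) = mor R E E (?g \<circ> id) u"
      using e E u by (intro minion_comp[OF R finE D finE, symmetric]) auto
    also have "\<dots> = mor R E E id u" using e E u by (intro minion_cong[OF R finE finE]) auto
    finally show ?thesis using minion_id[OF R finE u] by simp
  qed
  show ?thesis using retract[OF st(1)] retract[OF st(2)] st(3) by metis
qed

text \<open>
  Where the arc-consistent domain is empty, \<open>obj R {} \<rightarrow> obj R D\<close> need not be injective, so
  preimages there could be incompatible. Emptiness is preserved by the constraints,
  hence a single element of \<open>obj R {}\<close> can be used for all such variables.
\<close>

lemma lc_solution_omega_to_arc:
  assumes R: "is_minion R" and wf: "lc_wf \<D>" and p: "lc_solution \<D> (omega R) p"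
  shows "\<exists>s. lc_solution (arc \<D>) R s"
proof -
  let ?E = "ldom (arc \<D>)" and ?D = "ldom \<D>"
  have im: "fst (p x) = \<alpha> ` fst (p y)" if "(x, \<alpha>, y) \<in> lcons \<D>" for x \<alpha> y
    using lc_solution_cons[OF p that] by (simp add: omega_def case_prod_beta)
  have pobj: "(fst (p x), snd (p x)) \<in> obj (omega R) (?D x)" if "x \<in> lvars \<D>" for x
    using lc_solution_obj[OF p that] by simp
  \<comment> \<open>The marks form an arc-consistent family themselves, hence lie below the largest
    one. So \<open>omega_factor\<close> can pull every value back to the arc-consistent
    subdomain.\<close>
  have "arc_consistent \<D> (\<lambda>x. fst (p x))"
    unfolding arc_consistent_def
  proof (intro conjI ballI)
    show "fst (p x) \<subseteq> ?D x" if "x \<in> lvars \<D>" for x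
      using pobj[OF that] by (simp add: omega_def dummy_pairs_def case_prod_beta)
    show "case c of (x, \<alpha>, y) \<Rightarrow> fst (p x) = \<alpha> ` fst (p y)" if "c \<in> lcons \<D>" for c
      using that im by (cases c) simp
  qed
  then have sub: "fst (p x) \<subseteq> ?E x" for x by (rule arc_greatest)
  have "\<exists>s. s \<in> obj R (?E x) \<and> mor R (?E x) (?D x) id s = snd (p x)" if "x \<in> lvars \<D>" for x
    using omega_factor[OF R lc_wf_finite[OF wf that] pobj[OF that] sub ldom_arc_subset[OF that]]
    by metis
  then obtain s where s: "\<And>x. x \<in> lvars \<D> \<Longrightarrow> s x \<in> obj R (?E x)"
      "\<And>x. x \<in> lvars \<D> \<Longrightarrow> mor R (?E x) (?D x) id (s x) = snd (p x)" by metis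
  define s' where "s' = (\<lambda>x\<in>lvars \<D>. if ?E x = {} then (SOME t. t \<in> obj R {}) else s x)"
  have s'_obj: "s' x \<in> obj R (?E x)" if "x \<in> lvars \<D>" for x
    using s(1)[OF that] that by (auto simp: s'_def intro: someI)
  have "lc_solution (arc \<D>) R s'"
  proof (rule lc_solutionI)
    fix x \<alpha> y assume "(x, \<alpha>, y) \<in> lcons (arc \<D>)"
    then have c: "(x, \<alpha>, y) \<in> lcons \<D>" by simp
    note wfc = lc_wf_cons[OF wf c]
    have sub: "?E x \<subseteq> ?D x" "?E y \<subseteq> ?D y" using ldom_arc_subset[of x \<D>] ldom_arc_subset[of y \<D>] wfc by simp_all
    have fin: "finite (?D x)" "finite (?E x)" "finite (?D y)" "finite (?E y)"
      using lc_wf_finite[OF wf] lc_wf_finite[OF lc_wf_arc[OF wf]] wfc by simp_all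
    have im': "?E x = \<alpha> ` ?E y" by (rule ldom_arc_image[OF c])
    show "s' x = mor R (?E y) (?E x) \<alpha> (s' y)"
    proof (cases "?E y = {}")
      case True
      then have e: "?E x = {}" using im' by simp
      have t: "s' x = s' y" using True e wfc by (simp add: s'_def)
      have y: "s' y \<in> obj R {}" using s'_obj[of y] wfc True by simp
      have "mor R {} {} \<alpha> (s' y) = mor R {} {} id (s' y)"
        using y by (intro minion_cong[OF R]) auto
      then show ?thesis using minion_id[OF R _ y] t True e by simp
    next
      case False
      then have ne: "?E x \<noteq> {}" using im' by simp
      have sx: "s' x = s x" "s' y = s y" using False ne wfc by (simp_all add: s'_def)
      have \<alpha>E: "\<alpha> \<in> ?E y \<rightarrow> ?E x" using im' by auto
      have sy: "s y \<in> obj R (?E y)" using s wfc by blast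
      \<comment> \<open>The two sides are compared after inclusion into the full domain, where the
        constraint is known for \<open>p\<close>; injectivity of the inclusion then gives the
        constraint for the preimages.\<close>
      have "mor R (?E x) (?D x) id (mor R (?E y) (?E x) \<alpha> (s y)) = mor R (?E y) (?D x) (id \<circ> \<alpha>) (s y)"
        using sub by (intro minion_comp[OF R fin(4) fin(2) fin(1) \<alpha>E _ sy, symmetric]) auto
      also have "\<dots> = mor R (?E y) (?D x) (\<alpha> \<circ> id) (s y)" by simp
      also have "\<dots> = mor R (?D y) (?D x) \<alpha> (mor R (?E y) (?D y) id (s y))"
        using sub wfc by (intro minion_comp[OF R fin(4) fin(3) fin(1) _ _ sy]) auto
      also have "\<dots> = mor R (?D y) (?D x) \<alpha> (snd (p y))" using s wfc by simp
      also have "\<dots> = snd (p x)"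
        using lc_solution_cons[OF p c] by (simp add: omega_def case_prod_beta)
      also have "\<dots> = mor R (?E x) (?D x) id (s x)" using s wfc by simp
      finally have "mor R (?E x) (?D x) id (s x) =
          mor R (?E x) (?D x) id (mor R (?E y) (?E x) \<alpha> (s y))" by (rule sym)
      then have "s x = mor R (?E y) (?E x) \<alpha> (s y)"
        by (rule mor_inclusion_inj[OF R fin(1) sub(1) ne s(1)[OF conjunct1[OF wfc]]
              minion_mor[OF R fin(4) fin(2) \<alpha>E sy]])
      then show ?thesis unfolding sx .
    qed
  qed (simp_all add: s'_obj, simp add: s'_def)
  then show ?thesis by blast
qed


section \<open>The reduction \<open>csp\<close> and polymorphisms\<close>

lemma csp_equiv_sym: "(p, q) \<in> csp_equiv \<A> \<D> \<Longrightarrow> (q, p) \<in> csp_equiv \<A> \<D>"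
  using sym_rtrancl[OF sym_Un_converse, of "csp_step \<A> \<D>"] by (auto simp: csp_equiv_def dest: symD)

lemma csp_equiv_class_eq:
  "(p, q) \<in> csp_equiv \<A> \<D> \<Longrightarrow> csp_equiv \<A> \<D> `` {p} = csp_equiv \<A> \<D> `` {q}"
  using csp_equiv_sym[of p q \<A> \<D>] unfolding csp_equiv_def by (auto intro: rtrancl_trans)

lemma obj_Pol_iff:
  "f \<in> obj (Pol \<Sigma> \<A> \<B>) D \<longleftrightarrow> f \<in> (D \<rightarrow>\<^sub>E universe \<A>) \<rightarrow>\<^sub>E universe \<B> \<and>
     (\<forall>R\<in>syms \<Sigma>. \<forall>t\<in>tuples (ar \<Sigma> R) (D \<rightarrow>\<^sub>E universe \<A>).
        (\<forall>d\<in>D. map (\<lambda>a. a d) t \<in> rel \<A> R) \<longrightarrow> map f t \<in> rel \<B> R)"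
  by (auto simp: Pol_def struct_hom_def struct_pow_def PiE_iff)

text \<open>The polymorphism at \<open>x\<close> sends \<open>a\<close> to the value of the solution
  at the class of \<open>(x, a)\<close>. Relational constraints of \<open>csp\<close> make it a
  homomorphism, and the identifications of \<open>csp\<close> are exactly the label cover
  constraints.\<close>

lemma lc_solution_Pol_if_csp_solvable:
  assumes fin: "finite (csp_cons \<Sigma> \<A> \<D>)" and wf: "lc_wf \<D>"
    and sol: "solvable_in (csp \<Sigma> \<A> \<D>) \<B>"
  shows "\<exists>f. lc_solution \<D> (Pol \<Sigma> \<A> \<B>) f"
proof -
  let ?cl = "\<lambda>x a. csp_equiv \<A> \<D> `` {(x, a)}"
  obtain s where s: "s \<in> ivars (csp \<Sigma> \<A> \<D>) \<rightarrow> universe \<B>"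
      and s_cons: "\<And>R xs. (R, xs) \<in> csp_cons \<Sigma> \<A> \<D> \<Longrightarrow> map s xs \<in> rel \<B> R"
    using sol unfolding solvable_in_def set_icons_csp[OF fin] by blast
  define f where "f = (\<lambda>x\<in>lvars \<D>. \<lambda>a\<in>ldom \<D> x \<rightarrow>\<^sub>E universe \<A>. s (?cl x a))"
  have "lc_solution \<D> (Pol \<Sigma> \<A> \<B>) f"
  proof (rule lc_solutionI)
    fix x assume x: "x \<in> lvars \<D>"
    have "f x \<in> (ldom \<D> x \<rightarrow>\<^sub>E universe \<A>) \<rightarrow>\<^sub>E universe \<B>"
    proof (unfold f_def restrict_apply'[OF x], intro restrict_PiE_iff[THEN iffD2] ballI)
      fix a assume "a \<in> ldom \<D> x \<rightarrow>\<^sub>E universe \<A>"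
      then have "?cl x a \<in> ivars (csp \<Sigma> \<A> \<D>)"
        using x by (auto simp: csp_def csp_pairs_def intro!: quotientI)
      then show "s (?cl x a) \<in> universe \<B>" using s by auto
    qed
    moreover have "map (f x) t \<in> rel \<B> R"
      if R: "R \<in> syms \<Sigma>" and t: "t \<in> tuples (ar \<Sigma> R) (ldom \<D> x \<rightarrow>\<^sub>E universe \<A>)"
        "\<forall>d\<in>ldom \<D> x. map (\<lambda>a. a d) t \<in> rel \<A> R" for R t
    proof -
      have "(R, map (?cl x) t) \<in> csp_cons \<Sigma> \<A> \<D>" using R t x by (auto simp: csp_cons_def)
      then have "map s (map (?cl x) t) \<in> rel \<B> R" by (rule s_cons)
      moreover have "map s (map (?cl x) t) = map (f x) t"
        using t(1) x by (auto simp: f_def tuples_def)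
      ultimately show ?thesis by metis
    qed
    ultimately show "f x \<in> obj (Pol \<Sigma> \<A> \<B>) (ldom \<D> x)" unfolding obj_Pol_iff by blast
  next
    fix x \<alpha> y assume c: "(x, \<alpha>, y) \<in> lcons \<D>"
    note wfc = lc_wf_cons[OF wf c]
    have "s (?cl x a) = f y (restrict (a \<circ> \<alpha>) (ldom \<D> y))"
      if a: "a \<in> ldom \<D> x \<rightarrow>\<^sub>E universe \<A>" for a
    proof -
      let ?b = "restrict (a \<circ> \<alpha>) (ldom \<D> y)"
      have b: "?b \<in> ldom \<D> y \<rightarrow>\<^sub>E universe \<A>" using a wfc by auto
      have "((x, a), (y, ?b)) \<in> csp_step \<A> \<D>" using a c by (auto simp: csp_step_def)
      then have "((x, a), (y, ?b)) \<in> csp_equiv \<A> \<D>" by (auto simp: csp_equiv_def)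
      then show ?thesis using wfc b by (simp add: f_def csp_equiv_class_eq)
    qed
    then show "f x = mor (Pol \<Sigma> \<A> \<B>) (ldom \<D> y) (ldom \<D> x) \<alpha> (f y)"
      using wfc by (simp add: f_def Pol_def cong: restrict_cong)
  qed (simp add: f_def)
  then show ?thesis by blast
qed

text \<open>The values \<open>f x a\<close> descend to the quotient, because one step of the
  equivalence is a constraint of \<open>\<D>\<close> evaluated at \<open>a\<close>.\<close>

lemma csp_solvable_if_lc_solution_Pol:
  assumes fin: "finite (csp_cons \<Sigma> \<A> \<D>)" and f: "lc_solution \<D> (Pol \<Sigma> \<A> \<B>) f"
  shows "solvable_in (csp \<Sigma> \<A> \<D>) \<B>"
proof -
  let ?g = "\<lambda>(x, a). f x a"
  have step: "?g p = ?g q" if pq: "(p, q) \<in> csp_step \<A> \<D>" for p q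
  proof -
    obtain x \<alpha> y a where *: "p = (x, a)" "q = (y, restrict (a \<circ> \<alpha>) (ldom \<D> y))"
        "(x, \<alpha>, y) \<in> lcons \<D>" "a \<in> ldom \<D> x \<rightarrow>\<^sub>E universe \<A>"
      using pq unfolding csp_step_def by blast
    have "f x a = mor (Pol \<Sigma> \<A> \<B>) (ldom \<D> y) (ldom \<D> x) \<alpha> (f y) a"
      using lc_solution_cons[OF f *(3)] by (rule arg_cong)
    then show ?thesis using * by (simp add: Pol_def)
  qed
  have equiv: "?g p = ?g q" if "(p, q) \<in> csp_equiv \<A> \<D>" for p q
    using that unfolding csp_equiv_def
    by (induction rule: rtrancl_induct) (simp, metis UnE converseD step)
  \<comment> \<open>The representative is arbitrary; by \<open>equiv\<close> it does not influence
    the value.\<close>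
  define s where "s c = ?g (SOME p. p \<in> c)" for c
  have s: "s (csp_equiv \<A> \<D> `` {p}) = ?g p" for p
  proof -
    have "p \<in> csp_equiv \<A> \<D> `` {p}" by (simp add: csp_equiv_def)
    then have "(SOME q. q \<in> csp_equiv \<A> \<D> `` {p}) \<in> csp_equiv \<A> \<D> `` {p}" by (rule someI)
    then have "?g p = ?g (SOME q. q \<in> csp_equiv \<A> \<D> `` {p})" by (intro equiv) blast
    then show ?thesis by (simp add: s_def)
  qed
  have obj: "f x \<in> obj (Pol \<Sigma> \<A> \<B>) (ldom \<D> x)" if "x \<in> lvars \<D>" for x
    using lc_solution_obj[OF f that] .
  have "s \<in> ivars (csp \<Sigma> \<A> \<D>) \<rightarrow> universe \<B>"
  proof
    fix c assume "c \<in> ivars (csp \<Sigma> \<A> \<D>)"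
    then obtain x a where "x \<in> lvars \<D>" "a \<in> ldom \<D> x \<rightarrow>\<^sub>E universe \<A>" "c = csp_equiv \<A> \<D> `` {(x, a)}"
      by (auto simp: csp_def csp_pairs_def elim!: quotientE)
    then show "s c \<in> universe \<B>" using obj[of x] by (auto simp: s obj_Pol_iff)
  qed
  moreover have "map s xs \<in> rel \<B> R" if Rxs: "(R, xs) \<in> csp_cons \<Sigma> \<A> \<D>" for R xs
  proof -
    obtain x as where *: "xs = map (\<lambda>a. csp_equiv \<A> \<D> `` {(x, a)}) as" "R \<in> syms \<Sigma>" "x \<in> lvars \<D>"
        "as \<in> tuples (ar \<Sigma> R) (ldom \<D> x \<rightarrow>\<^sub>E universe \<A>)" "\<forall>d\<in>ldom \<D> x. map (\<lambda>a. a d) as \<in> rel \<A> R"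
      using Rxs by (auto simp: csp_cons_def)
    have "map s xs = map (f x) as" by (simp add: *(1) s)
    then show ?thesis using obj[OF *(3)] *(2,4,5) unfolding obj_Pol_iff by simp
  qed
  ultimately show ?thesis unfolding solvable_in_def set_icons_csp[OF fin] by blast
qed

text \<open>A consistent labelling solves the instance by projections, which are polymorphisms from
  any structure to itself. This serves the completeness half of the reduction.\<close>

lemma lc_solution_Pol_projections:
  assumes wf: "lc_wf \<D>" and d: "\<And>x. x \<in> lvars \<D> \<Longrightarrow> d x \<in> ldom \<D> x"
    and cons: "\<And>x \<alpha> y. (x, \<alpha>, y) \<in> lcons \<D> \<Longrightarrow> \<alpha> (d y) = d x"
  shows "lc_solution \<D> (Pol \<Sigma> \<A> \<A>) (\<lambda>x\<in>lvars \<D>. \<lambda>a\<in>ldom \<D> x \<rightarrow>\<^sub>E universe \<A>. a (d x))"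
    (is "lc_solution _ _ ?f")
proof (rule lc_solutionI)
  fix x assume x: "x \<in> lvars \<D>"
  have 1: "map (?f x) t = map (\<lambda>a. a (d x)) t" if "t \<in> tuples n (ldom \<D> x \<rightarrow>\<^sub>E universe \<A>)" for t n
    using that x by (auto simp: tuples_def)
  have 2: "?f x \<in> (ldom \<D> x \<rightarrow>\<^sub>E universe \<A>) \<rightarrow>\<^sub>E universe \<A>"
    using d[OF x] x by (auto simp: PiE_iff)
  show "?f x \<in> obj (Pol \<Sigma> \<A> \<A>) (ldom \<D> x)"
    unfolding obj_Pol_iff
  proof (intro conjI ballI impI 2)
    fix R t
    assume t: "t \<in> tuples (ar \<Sigma> R) (ldom \<D> x \<rightarrow>\<^sub>E universe \<A>)"
      and rel: "\<forall>d\<in>ldom \<D> x. map (\<lambda>a. a d) t \<in> rel \<A> R"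
    show "map (?f x) t \<in> rel \<A> R" unfolding 1[OF t] using rel d[OF x] by blast
  qed
next
  fix x \<alpha> y assume c: "(x, \<alpha>, y) \<in> lcons \<D>"
  note wfc = lc_wf_cons[OF wf c]
  have "a (d x) = ?f y (restrict (a \<circ> \<alpha>) (ldom \<D> y))" if a: "a \<in> ldom \<D> x \<rightarrow>\<^sub>E universe \<A>" for a
  proof -
    have "restrict (a \<circ> \<alpha>) (ldom \<D> y) \<in> ldom \<D> y \<rightarrow>\<^sub>E universe \<A>" using a wfc by auto
    then show ?thesis using wfc d[of y] cons[OF c] by simp
  qed
  then show "?f x = mor (Pol \<Sigma> \<A> \<A>) (ldom \<D> y) (ldom \<D> x) \<alpha> (?f y)"
    unfolding Pol_def minion.simps restrict_apply'[OF conjunct1[OF wfc]] by (rule restrict_ext)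
qed simp


section \<open>Indexed tuples and saturated powers\<close>

text \<open>Tuples are written through index functions, so that products and maps can be treated
  coordinatewise, with function update for exchanging one coordinate and \<open>case_nat\<close> for
  prepending one. Values from \<open>k\<close> on are irrelevant.\<close>

definition tup :: "nat \<Rightarrow> (nat \<Rightarrow> 'a) \<Rightarrow> 'a list" where
  "tup k x = map x [0..<k]"

definition prodn :: "nat \<Rightarrow> (nat \<Rightarrow> 'c elt set) \<Rightarrow> 'c elt set" where
  "prodn k C = set_prod (tup k C)"

definition mapn :: "nat \<Rightarrow> (nat \<Rightarrow> 'c elt \<Rightarrow> 'c elt) \<Rightarrow> 'c elt \<Rightarrow> 'c elt" where
  "mapn k f = prod_map (tup k f)"

lemma length_tup [simp]: "length (tup k x) = k"
  and nth_tup [simp]: "i < k \<Longrightarrow> tup k x ! i = x i"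
  and map_tup: "map g (tup k x) = tup k (\<lambda>i. g (x i))"
  and tup_Suc: "tup (Suc n) x = x 0 # tup n (\<lambda>i. x (Suc i))"
  by (simp_all add: tup_def o_def map_upt_Suc del: upt_Suc)

lemma tup_eq_iff: "tup k x = tup k y \<longleftrightarrow> (\<forall>i<k. x i = y i)"
  by (auto simp: list_eq_iff_nth_eq)

lemma tup_nth: "length xs = k \<Longrightarrow> tup k ((!) xs) = xs"
  by (simp add: list_eq_iff_nth_eq)

lemma tup_in_tuples_iff [simp]: "tup k x \<in> tuples k A \<longleftrightarrow> (\<forall>i<k. x i \<in> A)"
  by (auto simp: tuples_def tup_def)

lemma tuplesE:
  assumes "xs \<in> tuples k A"
  obtains x where "xs = tup k x" "\<And>i. i < k \<Longrightarrow> x i \<in> A"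
  using assms tup_nth[of xs k] that[of "(!) xs"] by (auto simp: tuples_def subset_iff)

lemma listset_iff: "es \<in> listset Ds \<longleftrightarrow> length es = length Ds \<and> (\<forall>i<length Ds. es ! i \<in> Ds ! i)"
  by (induction Ds arbitrary: es) (auto simp: set_Cons_def All_less_Suc2 length_Suc_conv)

lemma mem_prodn_iff: "u \<in> prodn k C \<longleftrightarrow> (\<exists>d. u = Tup (tup k d) \<and> (\<forall>i<k. d i \<in> C i))"
proof
  assume "u \<in> prodn k C"
  then obtain es where "u = Tup es" "length es = k" "\<forall>i<k. es ! i \<in> C i"
    by (auto simp: prodn_def set_prod_def listset_iff)
  then show "\<exists>d. u = Tup (tup k d) \<and> (\<forall>i<k. d i \<in> C i)"
    using tup_nth[of es k] by (intro exI[of _ "(!) es"]) simp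
qed (auto simp: prodn_def set_prod_def listset_iff)

lemma prodn_cong: "(\<And>i. i < k \<Longrightarrow> C i = C' i) \<Longrightarrow> prodn k C = prodn k C'"
  unfolding prodn_def by (metis tup_eq_iff)

lemma mapn_cong: "(\<And>i. i < k \<Longrightarrow> f i = g i) \<Longrightarrow> mapn k f = mapn k g"
  unfolding mapn_def by (metis tup_eq_iff)

lemma mapn_tup [simp]: "mapn k f (Tup (tup k d)) = Tup (tup k (\<lambda>i. f i (d i)))"
  by (simp add: mapn_def prod_map_def list_eq_iff_nth_eq)

lemma sigma_star_tup [simp]:
  "\<sigma> \<in> {..<k} \<rightarrow> {..<k} \<Longrightarrow> sigma_star k \<sigma> (Tup (tup k d)) = Tup (tup k (\<lambda>i. d (\<sigma> i)))"
  by (simp add: sigma_star_def list_eq_iff_nth_eq Pi_iff)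

lemma finite_prodn: "(\<And>i. i < k \<Longrightarrow> finite (C i)) \<Longrightarrow> finite (prodn k C)"
  unfolding prodn_def by (rule finite_set_prod) (auto simp: tup_def)

lemma mapn_funcset: "(\<And>i. i < k \<Longrightarrow> f i \<in> C i \<rightarrow> C' i) \<Longrightarrow> mapn k f \<in> prodn k C \<rightarrow> prodn k C'"
  by (fastforce simp: mem_prodn_iff)

lemma sigma_star_funcset:
  "\<sigma> \<in> {..<k} \<rightarrow> {..<k} \<Longrightarrow> sigma_star k \<sigma> \<in> prodn k C \<rightarrow> prodn k (\<lambda>i. C (\<sigma> i))"
  by (fastforce simp: mem_prodn_iff)

lemma
  assumes R: "is_minion R" and fin: "\<And>i. i < k \<Longrightarrow> finite (C i)" "\<And>i. i < k \<Longrightarrow> finite (C' i)"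
    and \<alpha>: "\<And>i. i < k \<Longrightarrow> \<alpha> i \<in> C i \<rightarrow> C' i" and u: "u \<in> obj R (prodn k C)"
  shows mor_mapn_obj: "mor R (prodn k C) (prodn k C') (mapn k \<alpha>) u \<in> obj R (prodn k C')"
    and mor_mapn_comp: "\<lbrakk>\<And>i. i < k \<Longrightarrow> finite (C'' i); \<And>i. i < k \<Longrightarrow> \<beta> i \<in> C' i \<rightarrow> C'' i\<rbrakk> \<Longrightarrow>
      mor R (prodn k C') (prodn k C'') (mapn k \<beta>) (mor R (prodn k C) (prodn k C') (mapn k \<alpha>) u) =
      mor R (prodn k C) (prodn k C'') (mapn k (\<lambda>i. \<beta> i \<circ> \<alpha> i)) u"
proof -
  show "mor R (prodn k C) (prodn k C') (mapn k \<alpha>) u \<in> obj R (prodn k C')"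
    using fin \<alpha> u by (intro minion_mor[OF R] finite_prodn mapn_funcset) auto
  assume C'': "\<And>i. i < k \<Longrightarrow> finite (C'' i)" and \<beta>: "\<And>i. i < k \<Longrightarrow> \<beta> i \<in> C' i \<rightarrow> C'' i"
  have "mor R (prodn k C) (prodn k C'') (mapn k (\<lambda>i. \<beta> i \<circ> \<alpha> i)) u =
      mor R (prodn k C) (prodn k C'') (mapn k \<beta> \<circ> mapn k \<alpha>) u"
    using fin C'' \<alpha> \<beta> u
    by (intro minion_cong[OF R] finite_prodn mapn_funcset) (fastforce simp: mem_prodn_iff)+
  also have "\<dots> = mor R (prodn k C') (prodn k C'') (mapn k \<beta>) (mor R (prodn k C) (prodn k C') (mapn k \<alpha>) u)"
    using fin C'' \<alpha> \<beta> u by (intro minion_comp[OF R] finite_prodn mapn_funcset) auto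
  finally show "mor R (prodn k C') (prodn k C'') (mapn k \<beta>) (mor R (prodn k C) (prodn k C') (mapn k \<alpha>) u) =
      mor R (prodn k C) (prodn k C'') (mapn k (\<lambda>i. \<beta> i \<circ> \<alpha> i)) u" ..
qed

text \<open>Naturality of reindexing: both composites send a tuple \<open>d\<close> to the tuple
  with entries \<open>\<alpha> (\<sigma> i) (d (\<sigma> i))\<close>.\<close>

lemma mor_sigma_star_mapn:
  assumes R: "is_minion R" and fin: "\<And>i. i < k \<Longrightarrow> finite (C i)" "\<And>i. i < k \<Longrightarrow> finite (C' i)"
    and \<alpha>: "\<And>i. i < k \<Longrightarrow> \<alpha> i \<in> C i \<rightarrow> C' i" and u: "u \<in> obj R (prodn k C)"
    and \<sigma>: "\<sigma> \<in> {..<k} \<rightarrow> {..<k}"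
  shows "mor R (prodn k C') (prodn k (\<lambda>i. C' (\<sigma> i))) (sigma_star k \<sigma>)
      (mor R (prodn k C) (prodn k C') (mapn k \<alpha>) u) =
    mor R (prodn k (\<lambda>i. C (\<sigma> i))) (prodn k (\<lambda>i. C' (\<sigma> i))) (mapn k (\<lambda>i. \<alpha> (\<sigma> i)))
      (mor R (prodn k C) (prodn k (\<lambda>i. C (\<sigma> i))) (sigma_star k \<sigma>) u)"
proof -
  have \<sigma>': "\<sigma> i < k" if "i < k" for i using \<sigma> that by auto
  note finites = finite_prodn[of k C] finite_prodn[of k C'] finite_prodn[of k "\<lambda>i. C (\<sigma> i)"]
    finite_prodn[of k "\<lambda>i. C' (\<sigma> i)"]
  note maps = mapn_funcset[of k \<alpha> C C'] mapn_funcset[of k "\<lambda>i. \<alpha> (\<sigma> i)" "\<lambda>i. C (\<sigma> i)" "\<lambda>i. C' (\<sigma> i)"]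
    sigma_star_funcset[OF \<sigma>, of C] sigma_star_funcset[OF \<sigma>, of C']
  have "mor R (prodn k C') (prodn k (\<lambda>i. C' (\<sigma> i))) (sigma_star k \<sigma>)
      (mor R (prodn k C) (prodn k C') (mapn k \<alpha>) u) =
      mor R (prodn k C) (prodn k (\<lambda>i. C' (\<sigma> i))) (sigma_star k \<sigma> \<circ> mapn k \<alpha>) u"
    using fin \<alpha> u \<sigma>' finites maps by (intro minion_comp[OF R, symmetric]) auto
  also have "\<dots> = mor R (prodn k C) (prodn k (\<lambda>i. C' (\<sigma> i))) (mapn k (\<lambda>i. \<alpha> (\<sigma> i)) \<circ> sigma_star k \<sigma>) u"
  proof (intro minion_cong[OF R])
    show "sigma_star k \<sigma> \<circ> mapn k \<alpha> \<in> prodn k C \<rightarrow> prodn k (\<lambda>i. C' (\<sigma> i))"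
      using \<alpha> maps by (simp add: Pi_iff)
    show "(sigma_star k \<sigma> \<circ> mapn k \<alpha>) d = (mapn k (\<lambda>i. \<alpha> (\<sigma> i)) \<circ> sigma_star k \<sigma>) d"
      if "d \<in> prodn k C" for d using that \<sigma> by (auto simp: mem_prodn_iff)
  qed (use fin finites \<sigma>' u in auto)
  also have "\<dots> = mor R (prodn k (\<lambda>i. C (\<sigma> i))) (prodn k (\<lambda>i. C' (\<sigma> i))) (mapn k (\<lambda>i. \<alpha> (\<sigma> i)))
      (mor R (prodn k C) (prodn k (\<lambda>i. C (\<sigma> i))) (sigma_star k \<sigma>) u)"
    using fin \<alpha> u \<sigma>' finites maps by (intro minion_comp[OF R]) auto
  finally show ?thesis .
qed

lemma mor_mapn_id:
  assumes R: "is_minion R" and fin: "\<And>i. i < k \<Longrightarrow> finite (C i)"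
    and \<alpha>: "\<And>i. i < k \<Longrightarrow> \<alpha> i = id" and u: "u \<in> obj R (prodn k C)"
  shows "mor R (prodn k C) (prodn k C) (mapn k \<alpha>) u = u"
proof -
  have "mor R (prodn k C) (prodn k C) (mapn k \<alpha>) u = mor R (prodn k C) (prodn k C) id u"
    using fin \<alpha> u
    by (intro minion_cong[OF R] finite_prodn mapn_funcset) (auto simp: mem_prodn_iff tup_eq_iff)
  then show ?thesis using minion_id[OF R finite_prodn u] fin by simp
qed

section \<open>Constraints of saturated powers in indexed form\<close>

definition lcons_id :: "('v, 'u) lc \<Rightarrow> ('v \<times> ('u \<Rightarrow> 'u) \<times> 'v) set" where
  "lcons_id \<D> = lcons \<D> \<union> {(x, id, x) | x. x \<in> lvars \<D>}"

lemma lvars_pow [simp]: "lvars (lc_pow k \<D>) = tuples k (lvars \<D>)"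
  by (simp add: lc_pow_def Let_def)

lemma ldom_pow [simp]: "ldom (lc_pow k \<D>) (tup k x) = prodn k (\<lambda>i. ldom \<D> (x i))"
  by (simp add: lc_pow_def Let_def prodn_def map_tup)

text \<open>All later arguments about constraints of a power split by this rule; it replaces the
  lists of triples by index functions.\<close>

lemma lcons_pow_cases:
  assumes "c \<in> lcons (lc_pow k \<D>)"
  obtains (product) x \<alpha> y where "\<And>i. i < k \<Longrightarrow> (x i, \<alpha> i, y i) \<in> lcons_id \<D>"
      "c = (tup k x, mapn k \<alpha>, tup k y)"
  | (reindex) x \<sigma> where "\<And>i. i < k \<Longrightarrow> x i \<in> lvars \<D>" "\<sigma> \<in> {..<k} \<rightarrow> {..<k}"
      "c = (tup k (\<lambda>i. x (\<sigma> i)), sigma_star k \<sigma>, tup k x)"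
proof -
  consider cs where "cs \<in> tuples k (lcons_id \<D>)"
      "c = (map (\<lambda>(x, \<alpha>, y). x) cs, prod_map (map (\<lambda>(x, \<alpha>, y). \<alpha>) cs), map (\<lambda>(x, \<alpha>, y). y) cs)"
    | xs \<sigma> where "xs \<in> tuples k (lvars \<D>)" "\<sigma> \<in> {..<k} \<rightarrow> {..<k}"
      "c = (map (\<lambda>i. xs ! \<sigma> i) [0..<k], sigma_star k \<sigma>, xs)"
    using assms unfolding lc_pow_def Let_def lcons_id_def lc.simps by blast
  then show thesis
  proof cases
    case 1
    then obtain t where t: "cs = tup k t" "\<And>i. i < k \<Longrightarrow> t i \<in> lcons_id \<D>" by (blast elim: tuplesE)
    show thesis
      using t 1(2)
      by (intro product[of "\<lambda>i. fst (t i)" "\<lambda>i. fst (snd (t i))" "\<lambda>i. snd (snd (t i))"])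
        (simp_all add: map_tup mapn_def case_prod_beta)
  next
    case 2
    then obtain x where x: "xs = tup k x" "\<And>i. i < k \<Longrightarrow> x i \<in> lvars \<D>" by (blast elim: tuplesE)
    have "map (\<lambda>i. xs ! \<sigma> i) [0..<k] = tup k (\<lambda>i. x (\<sigma> i))"
      using 2(2) x(1) by (simp add: tup_def[of k "\<lambda>i. x (\<sigma> i)"] Pi_iff)
    then show thesis using 2 x by (intro reindex) auto
  qed
qed

lemma lcons_pow_product:
  assumes "\<And>i. i < k \<Longrightarrow> (x i, \<alpha> i, y i) \<in> lcons_id \<D>"
  shows "(tup k x, mapn k \<alpha>, tup k y) \<in> lcons (lc_pow k \<D>)"
proof -
  let ?cs = "tup k (\<lambda>i. (x i, \<alpha> i, y i))"
  have "?cs \<in> tuples k (lcons_id \<D>)" using assms by simp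
  moreover have "(tup k x, mapn k \<alpha>, tup k y) =
      (map (\<lambda>(x, \<alpha>, y). x) ?cs, prod_map (map (\<lambda>(x, \<alpha>, y). \<alpha>) ?cs), map (\<lambda>(x, \<alpha>, y). y) ?cs)"
    by (simp add: map_tup mapn_def)
  ultimately show ?thesis unfolding lc_pow_def Let_def lcons_id_def lc.simps by blast
qed

lemma lcons_pow_reindex:
  assumes "\<And>i. i < k \<Longrightarrow> x i \<in> lvars \<D>" and \<sigma>: "\<sigma> \<in> {..<k} \<rightarrow> {..<k}"
  shows "(tup k (\<lambda>i. x (\<sigma> i)), sigma_star k \<sigma>, tup k x) \<in> lcons (lc_pow k \<D>)"
proof -
  have "tup k x \<in> tuples k (lvars \<D>)" using assms by simp
  moreover have "tup k (\<lambda>i. x (\<sigma> i)) = map (\<lambda>i. tup k x ! \<sigma> i) [0..<k]"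
    using \<sigma> by (simp add: tup_def[of k "\<lambda>i. x (\<sigma> i)"] Pi_iff)
  ultimately show ?thesis using \<sigma> unfolding lc_pow_def Let_def lc.simps by blast
qed

lemma lcons_id_wf:
  assumes "lc_wf \<D>" "(x, \<alpha>, y) \<in> lcons_id \<D>"
  shows "x \<in> lvars \<D> \<and> y \<in> lvars \<D> \<and> \<alpha> \<in> ldom \<D> y \<rightarrow> ldom \<D> x"
  using assms lc_wf_cons[OF assms(1), of x \<alpha> y] by (auto simp: lcons_id_def)

lemma lc_wf_pow:
  assumes wf: "lc_wf \<D>"
  shows "lc_wf (lc_pow k \<D>)"
  unfolding lc_wf_def
proof (intro conjI ballI)
  show "finite (lvars (lc_pow k \<D>))" using wf by (simp add: lc_wf_def finite_tuples)
  show "finite (ldom (lc_pow k \<D>) xs)" if "xs \<in> lvars (lc_pow k \<D>)" for xs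
    using that lc_wf_finite[OF wf] by (auto elim!: tuplesE intro!: finite_prodn)
  show "case c of (x, \<alpha>, y) \<Rightarrow> x \<in> lvars (lc_pow k \<D>) \<and> y \<in> lvars (lc_pow k \<D>) \<and>
      \<alpha> \<in> ldom (lc_pow k \<D>) y \<rightarrow> ldom (lc_pow k \<D>) x" if c: "c \<in> lcons (lc_pow k \<D>)" for c
    using c
  proof (cases rule: lcons_pow_cases)
    case (product x \<alpha> y)
    then show ?thesis using lcons_id_wf[OF wf product(1)] by (auto intro!: mapn_funcset)
  next
    case (reindex x \<sigma>)
    moreover have "x (\<sigma> i) \<in> lvars \<D>" if "i < k" for i using reindex(1,2) that by auto
    ultimately show ?thesis using sigma_star_funcset[of \<sigma> k "\<lambda>i. ldom \<D> (x i)"] by simp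
  qed
qed


section \<open>Solutions of powers from elements of a level\<close>

text \<open>The family \<open>w\<close> that \<open>z\<close> and \<open>\<beta>\<close> induce in
  the definition of \<open>lvl\<close>. Different pairs may induce the same family, which is the
  difficulty that \<open>push_eq\<close> resolves.\<close>

definition lvl_elt ::
    "nat \<Rightarrow> ('c elt, 'm) minion \<Rightarrow> ('c elt, 'c elt) lc \<Rightarrow> ('c elt list \<Rightarrow> 'm) \<Rightarrow> 'c elt set \<Rightarrow>
     'c elt \<Rightarrow> ('c elt \<Rightarrow> 'c elt) \<Rightarrow> 'c elt list \<Rightarrow> 'm" where
  "lvl_elt k R \<E> r C z \<beta> = (\<lambda>ys\<in>tuples (k - 1) (lvars \<E>).
     mor R (lvl_dom \<E> (ldom \<E> z) ys) (lvl_dom \<E> C ys) (lvl_map k \<beta>) (r (z # ys)))"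

lemma ldom_pow_Cons: "ldom (lc_pow k \<E>) (z # ys) = lvl_dom \<E> (ldom \<E> z) ys"
  by (simp add: lc_pow_def Let_def lvl_dom_def)

text \<open>Position 0 carries \<open>C\<close> and the later positions carry the domains of
  \<open>\<E>\<close>, shifted by one.\<close>

lemma lvl_dom_tup: "lvl_dom \<E> C (tup n y) = prodn (Suc n) (case_nat C (\<lambda>i. ldom \<E> (y i)))"
  by (simp add: lvl_dom_def prodn_def tup_Suc map_tup)

lemma lvl_map_mapn: "lvl_map (Suc n) \<beta> = mapn (Suc n) (case_nat \<beta> (\<lambda>_. id))"
  by (simp add: lvl_map_def mapn_def tup_Suc) (simp add: tup_def map_replicate_const)

locale pow_solution =
  fixes k :: nat and R :: "('c elt, 'm) minion" and \<E> :: "('c elt, 'c elt) lc"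
    and r :: "'c elt list \<Rightarrow> 'm"
  assumes R: "is_minion R" and k: "k \<ge> 1" and \<E>: "is_lc \<E>" and r: "lc_solution (lc_pow k \<E>) R r"
begin

text \<open>The image of \<open>r\<close> at \<open>z\<close> under the product of the maps
  \<open>\<beta> i\<close>; these are the values from which a solution of the power of another
  instance is built. The companion \<open>wt\<close> collects the typing conditions.\<close>

definition push :: "(nat \<Rightarrow> 'c elt set) \<Rightarrow> (nat \<Rightarrow> 'c elt) \<Rightarrow> (nat \<Rightarrow> 'c elt \<Rightarrow> 'c elt) \<Rightarrow> 'm" where
  "push C z \<beta> = mor R (prodn k (\<lambda>i. ldom \<E> (z i))) (prodn k C) (mapn k \<beta>) (r (tup k z))"

definition wt :: "(nat \<Rightarrow> 'c elt set) \<Rightarrow> (nat \<Rightarrow> 'c elt) \<Rightarrow> (nat \<Rightarrow> 'c elt \<Rightarrow> 'c elt) \<Rightarrow> bool" where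
  "wt C z \<beta> \<longleftrightarrow> (\<forall>i<k. finite (C i) \<and> z i \<in> lvars \<E> \<and> \<beta> i \<in> ldom \<E> (z i) \<rightarrow> C i)"

lemma finite_ldom: "z \<in> lvars \<E> \<Longrightarrow> finite (ldom \<E> z)"
  using \<E> by (simp add: is_lc_def)

lemma r_obj: "(\<And>i. i < k \<Longrightarrow> z i \<in> lvars \<E>) \<Longrightarrow> r (tup k z) \<in> obj R (prodn k (\<lambda>i. ldom \<E> (z i)))"
  using lc_solution_obj[OF r, of "tup k z"] by simp

lemma push_cong:
  assumes "\<And>i. i < k \<Longrightarrow> C i = C' i" "\<And>i. i < k \<Longrightarrow> z i = z' i" "\<And>i. i < k \<Longrightarrow> \<beta> i = \<beta>' i"
  shows "push C z \<beta> = push C' z' \<beta>'"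
proof -
  have "prodn k C = prodn k C'" "prodn k (\<lambda>i. ldom \<E> (z i)) = prodn k (\<lambda>i. ldom \<E> (z' i))"
    using assms by (simp_all cong: prodn_cong)
  moreover have "mapn k \<beta> = mapn k \<beta>'" "tup k z = tup k z'"
    using assms by (simp_all add: tup_eq_iff cong: mapn_cong)
  ultimately show ?thesis by (simp add: push_def)
qed

lemma push_obj: "wt C z \<beta> \<Longrightarrow> push C z \<beta> \<in> obj R (prodn k C)"
  unfolding push_def wt_def by (intro mor_mapn_obj[OF R] r_obj finite_ldom) auto

lemma mor_mapn_push:
  assumes "wt C z \<beta>" "\<And>i. i < k \<Longrightarrow> finite (C' i)" "\<And>i. i < k \<Longrightarrow> \<alpha> i \<in> C i \<rightarrow> C' i"
  shows "mor R (prodn k C) (prodn k C') (mapn k \<alpha>) (push C z \<beta>) = push C' z (\<lambda>i. \<alpha> i \<circ> \<beta> i)"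
  unfolding push_def using assms by (intro mor_mapn_comp[OF R] r_obj finite_ldom) (auto simp: wt_def)

text \<open>Since \<open>r\<close> satisfies the reindexing constraints, permuting or repeating
  coordinates of a value amounts to doing the same with \<open>z\<close> and
  \<open>\<beta>\<close>.\<close>

lemma mor_sigma_star_push:
  assumes wt: "wt C z \<beta>" and \<sigma>: "\<sigma> \<in> {..<k} \<rightarrow> {..<k}"
  shows "mor R (prodn k C) (prodn k (\<lambda>i. C (\<sigma> i))) (sigma_star k \<sigma>) (push C z \<beta>) =
    push (\<lambda>i. C (\<sigma> i)) (\<lambda>i. z (\<sigma> i)) (\<lambda>i. \<beta> (\<sigma> i))"
proof -
  have "(tup k (\<lambda>i. z (\<sigma> i)), sigma_star k \<sigma>, tup k z) \<in> lcons (lc_pow k \<E>)"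
    using wt \<sigma> by (intro lcons_pow_reindex) (auto simp: wt_def)
  from lc_solution_cons[OF r this]
  have "r (tup k (\<lambda>i. z (\<sigma> i))) = mor R (prodn k (\<lambda>i. ldom \<E> (z i)))
      (prodn k (\<lambda>i. ldom \<E> (z (\<sigma> i)))) (sigma_star k \<sigma>) (r (tup k z))" by simp
  then show ?thesis
    unfolding push_def using wt \<sigma>
    by (simp add: mor_sigma_star_mapn[OF R _ _ _ r_obj \<sigma>] finite_ldom wt_def)
qed

text \<open>A level element applies a map in the first coordinate only. Applying the maps of the
  other coordinates afterwards yields \<open>push\<close>, which therefore depends on
  \<open>z 0\<close> and \<open>\<beta> 0\<close> only through the level element.\<close>

lemma push_replace_first:
  assumes wt: "wt C z \<beta>" and z': "z' \<in> lvars \<E>" and \<beta>': "\<beta>' \<in> ldom \<E> z' \<rightarrow> C 0"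
    and eq: "lvl_elt k R \<E> r (C 0) (z 0) (\<beta> 0) = lvl_elt k R \<E> r (C 0) z' \<beta>'"
  shows "push C (z(0 := z')) (\<beta>(0 := \<beta>')) = push C z \<beta>"
proof -
  obtain n where n: "k = Suc n" using k by (cases k) auto
  let ?y = "\<lambda>i. z (Suc i)"
  \<comment> \<open>The intermediate product: coordinate 0 already mapped to \<open>C 0\<close>, all
    others still at their domains in \<open>\<E>\<close>.\<close>
  let ?C = "case_nat (C 0) (\<lambda>i. ldom \<E> (?y i))"
  have y: "tup n ?y \<in> tuples (k - 1) (lvars \<E>)" using wt unfolding wt_def by (simp add: n)
  have elt: "push C v \<gamma> = mor R (prodn k ?C) (prodn k C) (mapn k (case_nat id (\<lambda>i. \<beta> (Suc i))))
      (lvl_elt k R \<E> r (C 0) (v 0) (\<gamma> 0) (tup n ?y))"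
    if v: "wt C v \<gamma>" "\<And>i. v (Suc i) = z (Suc i)" "\<And>i. \<gamma> (Suc i) = \<beta> (Suc i)" for v \<gamma>
  proof -
    have vy: "tup k v = v 0 # tup n ?y" by (simp add: n tup_Suc v(2))
    have dom: "(\<lambda>i. ldom \<E> (v i)) = case_nat (ldom \<E> (v 0)) (\<lambda>i. ldom \<E> (?y i))"
      by (auto simp: fun_eq_iff v(2) split: nat.split)
    have "lvl_elt k R \<E> r (C 0) (v 0) (\<gamma> 0) (tup n ?y) = push ?C v (case_nat (\<gamma> 0) (\<lambda>_. id))"
      unfolding lvl_elt_def restrict_apply'[OF y] push_def vy dom
      by (simp add: lvl_dom_tup lvl_map_mapn n)
    moreover have "wt ?C v (case_nat (\<gamma> 0) (\<lambda>_. id))"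
      using v wt by (auto simp: wt_def finite_ldom split: nat.split)
    ultimately have "mor R (prodn k ?C) (prodn k C) (mapn k (case_nat id (\<lambda>i. \<beta> (Suc i))))
        (lvl_elt k R \<E> r (C 0) (v 0) (\<gamma> 0) (tup n ?y)) =
        push C v (\<lambda>i. case_nat id (\<lambda>i. \<beta> (Suc i)) i \<circ> case_nat (\<gamma> 0) (\<lambda>_. id) i)"
      using wt by (simp, intro mor_mapn_push) (auto simp: wt_def split: nat.split)
    also have "\<dots> = push C v \<gamma>"
      by (intro push_cong) (auto simp: v(3) split: nat.split)
    finally show ?thesis ..
  qed
  have "wt C (z(0 := z')) (\<beta>(0 := \<beta>'))" using wt z' \<beta>' by (auto simp: wt_def)
  then show ?thesis using elt[OF wt] elt[of "z(0 := z')" "\<beta>(0 := \<beta>')"] eq by simp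
qed

text \<open>Any coordinate can be moved to the front by a transposition, which is an involution.\<close>

lemma push_replace:
  assumes wt: "wt C z \<beta>" and j: "j < k" and z': "z' \<in> lvars \<E>" and \<beta>': "\<beta>' \<in> ldom \<E> z' \<rightarrow> C j"
    and eq: "lvl_elt k R \<E> r (C j) (z j) (\<beta> j) = lvl_elt k R \<E> r (C j) z' \<beta>'"
  shows "push C (z(j := z')) (\<beta>(j := \<beta>')) = push C z \<beta>"
proof -
  define \<sigma> where "\<sigma> i = (if i = 0 then j else if i = j then 0 else i)" for i
  have \<sigma>: "\<sigma> \<in> {..<k} \<rightarrow> {..<k}" and inv: "\<sigma> (\<sigma> i) = i" for i using j by (auto simp: \<sigma>_def)
  have \<sigma>_upd: "(f(j := a)) (\<sigma> i) = ((\<lambda>i. f (\<sigma> i))(0 := a)) i" for f :: "nat \<Rightarrow> 'z" and a i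
    by (auto simp: \<sigma>_def)
  have swap: "push C v \<gamma> = mor R (prodn k (\<lambda>i. C (\<sigma> i))) (prodn k C) (sigma_star k \<sigma>)
      (push (\<lambda>i. C (\<sigma> i)) (\<lambda>i. v (\<sigma> i)) (\<lambda>i. \<gamma> (\<sigma> i)))" if "wt C v \<gamma>" for v \<gamma>
  proof -
    have "wt (\<lambda>i. C (\<sigma> i)) (\<lambda>i. v (\<sigma> i)) (\<lambda>i. \<gamma> (\<sigma> i))" using that \<sigma> by (auto simp: wt_def Pi_iff)
    from mor_sigma_star_push[OF this \<sigma>] show ?thesis by (simp add: inv)
  qed
  have wt': "wt (\<lambda>i. C (\<sigma> i)) (\<lambda>i. z (\<sigma> i)) (\<lambda>i. \<beta> (\<sigma> i))" using wt \<sigma> by (auto simp: wt_def Pi_iff)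
  have "push (\<lambda>i. C (\<sigma> i)) ((\<lambda>i. z (\<sigma> i))(0 := z')) ((\<lambda>i. \<beta> (\<sigma> i))(0 := \<beta>')) =
      push (\<lambda>i. C (\<sigma> i)) (\<lambda>i. z (\<sigma> i)) (\<lambda>i. \<beta> (\<sigma> i))"
    using z' \<beta>' eq by (intro push_replace_first wt') (simp_all add: \<sigma>_def)
  then have "push (\<lambda>i. C (\<sigma> i)) (\<lambda>i. (z(j := z')) (\<sigma> i)) (\<lambda>i. (\<beta>(j := \<beta>')) (\<sigma> i)) =
      push (\<lambda>i. C (\<sigma> i)) (\<lambda>i. z (\<sigma> i)) (\<lambda>i. \<beta> (\<sigma> i))"
    unfolding \<sigma>_upd .
  moreover have "wt C (z(j := z')) (\<beta>(j := \<beta>'))" using wt z' \<beta>' by (auto simp: wt_def)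
  ultimately show ?thesis using swap[OF wt] swap[of "z(j := z')" "\<beta>(j := \<beta>')"] by simp
qed

text \<open>A hybrid argument: the coordinates are exchanged one after the other,
  \<open>zz j\<close> and \<open>bb j\<close> being the data after the first \<open>j\<close>
  exchanges.\<close>

lemma push_eq:
  assumes wt: "wt C z \<beta>" "wt C z' \<beta>'"
    and eq: "\<And>i. i < k \<Longrightarrow> lvl_elt k R \<E> r (C i) (z i) (\<beta> i) = lvl_elt k R \<E> r (C i) (z' i) (\<beta>' i)"
  shows "push C z \<beta> = push C z' \<beta>'"
proof -
  define zz where "zz j i = (if i < j then z' i else z i)" for j i
  define bb where "bb j i = (if i < j then \<beta>' i else \<beta> i)" for j i
  have "push C (zz j) (bb j) = push C z \<beta>" if "j \<le> k" for j
    using that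
  proof (induction j)
    case 0
    then show ?case by (intro push_cong) (auto simp: zz_def bb_def)
  next
    case (Suc j)
    have *: "zz (Suc j) = (zz j)(j := z' j)" "bb (Suc j) = (bb j)(j := \<beta>' j)"
      by (auto simp: zz_def bb_def)
    have "push C (zz (Suc j)) (bb (Suc j)) = push C (zz j) (bb j)"
      unfolding * using wt Suc.prems eq[of j]
      by (intro push_replace) (auto simp: wt_def zz_def bb_def)
    then show ?case using Suc by simp
  qed
  from this[of k] have "push C z \<beta> = push C (zz k) (bb k)" by simp
  also have "\<dots> = push C z' \<beta>'" by (intro push_cong) (auto simp: zz_def bb_def)
  finally show ?thesis .
qed

text \<open>In each entry, two maps acting in the first coordinate compose. Hence a constraint
  satisfied in the level says that two pairs, one for each of its variables, induce the same
  family.\<close>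

lemma lvl_mor_elt:
  assumes z: "z \<in> lvars \<E>" "\<beta> \<in> ldom \<E> z \<rightarrow> C" and C: "finite C" "finite C'" and \<alpha>: "\<alpha> \<in> C \<rightarrow> C'"
  shows "mor (lvl k R) C C' \<alpha> (\<E>, r, lvl_elt k R \<E> r C z \<beta>) =
    (\<E>, r, lvl_elt k R \<E> r C' z (\<alpha> \<circ> \<beta>))"
proof -
  obtain n where n: "k = Suc n" using k by (cases k) auto
  have "mor R (lvl_dom \<E> C ys) (lvl_dom \<E> C' ys) (lvl_map k \<alpha>) (lvl_elt k R \<E> r C z \<beta> ys) =
      lvl_elt k R \<E> r C' z (\<alpha> \<circ> \<beta>) ys" if ys: "ys \<in> tuples (k - 1) (lvars \<E>)" for ys
  proof -
    obtain y where y: "ys = tup n y" "\<And>i. i < n \<Longrightarrow> y i \<in> lvars \<E>"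
      using ys n by (auto elim: tuplesE)
    let ?D = "\<lambda>C. case_nat C (\<lambda>i. ldom \<E> (y i))"
    let ?v = "case_nat z y"
    have v: "r (z # ys) = r (tup k ?v)" "(\<lambda>i. ldom \<E> (?v i)) = ?D (ldom \<E> z)"
      by (auto simp: n y tup_Suc fun_eq_iff split: nat.split)
    have rv: "r (z # ys) \<in> obj R (prodn k (?D (ldom \<E> z)))"
      unfolding v(1) v(2)[symmetric] using z y n by (intro r_obj) (auto split: nat.split)
    have fin: "finite (?D E i)" if "i < k" "finite E" for i E
      using that y n by (auto simp: finite_ldom split: nat.split)
    have "mor R (prodn k (?D C)) (prodn k (?D C')) (mapn k (case_nat \<alpha> (\<lambda>_. id)))
        (mor R (prodn k (?D (ldom \<E> z))) (prodn k (?D C)) (mapn k (case_nat \<beta> (\<lambda>_. id))) (r (z # ys))) =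
      mor R (prodn k (?D (ldom \<E> z))) (prodn k (?D C'))
        (mapn k (\<lambda>i. case_nat \<alpha> (\<lambda>_. id) i \<circ> case_nat \<beta> (\<lambda>_. id) i)) (r (z # ys))"
      using C z \<alpha> finite_ldom by (intro mor_mapn_comp[OF R _ _ _ rv] fin) (auto split: nat.split)
    moreover have "mapn k (\<lambda>i. case_nat \<alpha> (\<lambda>_. id) i \<circ> case_nat \<beta> (\<lambda>_. id) i) =
        mapn k (case_nat (\<alpha> \<circ> \<beta>) (\<lambda>_. id))"
      by (intro mapn_cong) (auto split: nat.split)
    ultimately show ?thesis
      unfolding lvl_elt_def restrict_apply'[OF ys] by (simp add: y(1) lvl_dom_tup lvl_map_mapn n)
  qed
  then show ?thesis
    by (auto simp: lvl_def lvl_elt_def[of k R \<E> r C' z] intro!: restrict_ext)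
qed

text \<open>One pair \<open>z x\<close>, \<open>\<beta> x\<close> is chosen for each variable
  without regard to the constraints; \<open>push_eq\<close> repairs the mismatch. It is essential
  that all values of \<open>P\<close> lie over the same \<open>(\<E>, r)\<close>.\<close>

lemma pow_solution_of_lvl_solution:
  assumes wf: "lc_wf \<D>" and P: "lc_solution \<D> (lvl k R) P"
    and w: "\<And>x. x \<in> lvars \<D> \<Longrightarrow> \<exists>z\<in>lvars \<E>. \<exists>\<beta>\<in>ldom \<E> z \<rightarrow> ldom \<D> x.
      P x = (\<E>, r, lvl_elt k R \<E> r (ldom \<D> x) z \<beta>)"
  shows "\<exists>s. lc_solution (lc_pow k \<D>) R s"
proof -
  obtain z \<beta> where z: "\<And>x. x \<in> lvars \<D> \<Longrightarrow> z x \<in> lvars \<E>"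
      "\<And>x. x \<in> lvars \<D> \<Longrightarrow> \<beta> x \<in> ldom \<E> (z x) \<rightarrow> ldom \<D> x"
      "\<And>x. x \<in> lvars \<D> \<Longrightarrow> P x = (\<E>, r, lvl_elt k R \<E> r (ldom \<D> x) (z x) (\<beta> x))"
    using w by metis
  let ?push = "\<lambda>x. push (\<lambda>i. ldom \<D> (x i)) (\<lambda>i. z (x i)) (\<lambda>i. \<beta> (x i))"
  let ?s = "\<lambda>xs\<in>tuples k (lvars \<D>). ?push ((!) xs)"
  have s: "?s (tup k x) = ?push x" if "\<And>i. i < k \<Longrightarrow> x i \<in> lvars \<D>" for x
    using that by (auto intro: push_cong)
  have wt: "wt (\<lambda>i. ldom \<D> (x i)) (\<lambda>i. z (x i)) (\<lambda>i. \<beta> (x i))" if "\<And>i. i < k \<Longrightarrow> x i \<in> lvars \<D>" for x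
    using that z lc_wf_finite[OF wf] by (auto simp: wt_def)
  have "lc_solution (lc_pow k \<D>) R ?s"
  proof (rule lc_solutionI)
    fix xs assume "xs \<in> lvars (lc_pow k \<D>)"
    then obtain x where x: "xs = tup k x" "\<And>i. i < k \<Longrightarrow> x i \<in> lvars \<D>" by (auto elim: tuplesE)
    have "?s (tup k x) = ?push x" using x(2) by (rule s)
    then show "?s xs \<in> obj R (ldom (lc_pow k \<D>) xs)"
      unfolding x(1) ldom_pow using push_obj[OF wt[OF x(2)]] by simp
  next
    fix xs \<gamma> ys assume c: "(xs, \<gamma>, ys) \<in> lcons (lc_pow k \<D>)"
    then show "?s xs = mor R (ldom (lc_pow k \<D>) ys) (ldom (lc_pow k \<D>) xs) \<gamma> (?s ys)"
    proof (cases rule: lcons_pow_cases)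
      case (product x \<alpha> y)
      have xy: "x i \<in> lvars \<D>" "y i \<in> lvars \<D>" "\<alpha> i \<in> ldom \<D> (y i) \<rightarrow> ldom \<D> (x i)" if "i < k" for i
        using lcons_id_wf[OF wf product(1)[OF that]] by blast+
      have eq: "lvl_elt k R \<E> r (ldom \<D> (x i)) (z (x i)) (\<beta> (x i)) =
          lvl_elt k R \<E> r (ldom \<D> (x i)) (z (y i)) (\<alpha> i \<circ> \<beta> (y i))" if i: "i < k" for i
      proof (cases "(x i, \<alpha> i, y i) \<in> lcons \<D>")
        case True
        have "P (x i) = mor (lvl k R) (ldom \<D> (y i)) (ldom \<D> (x i)) (\<alpha> i) (P (y i))"
          by (rule lc_solution_cons[OF P True])
        also have "\<dots> = (\<E>, r, lvl_elt k R \<E> r (ldom \<D> (x i)) (z (y i)) (\<alpha> i \<circ> \<beta> (y i)))"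
          unfolding z(3)[OF xy(2)[OF i]] using z xy[OF i] lc_wf_finite[OF wf]
          by (intro lvl_mor_elt) auto
        finally show ?thesis using z(3)[OF xy(1)[OF i]] by simp
      next
        \<comment> \<open>What remains are the identity constraints that \<open>lc_pow\<close>
          adds.\<close>
        case False
        then show ?thesis using product(1)[OF i] by (auto simp: lcons_id_def)
      qed
      \<comment> \<open>After the exchange, every coordinate map factors through
        \<open>\<alpha> i\<close>, so the value is visibly the image of the value at
        \<open>y\<close>.\<close>
      have "?push x = push (\<lambda>i. ldom \<D> (x i)) (\<lambda>i. z (y i)) (\<lambda>i. \<alpha> i \<circ> \<beta> (y i))"
      proof (rule push_eq[OF wt])
        show "wt (\<lambda>i. ldom \<D> (x i)) (\<lambda>i. z (y i)) (\<lambda>i. \<alpha> i \<circ> \<beta> (y i))"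
          using xy z lc_wf_finite[OF wf] by (fastforce simp: wt_def Pi_iff)
      qed (use xy eq in auto)
      also have "\<dots> = mor R (prodn k (\<lambda>i. ldom \<D> (y i))) (prodn k (\<lambda>i. ldom \<D> (x i))) (mapn k \<alpha>) (?push y)"
        using xy lc_wf_finite[OF wf] by (intro mor_mapn_push[symmetric] wt) auto
      finally show ?thesis using s[OF xy(1)] s[OF xy(2)] product(2) by simp
    next
      case (reindex x \<sigma>)
      have \<sigma>: "x (\<sigma> i) \<in> lvars \<D>" if "i < k" for i using reindex(1,2) that by auto
      show ?thesis
        using mor_sigma_star_push[OF wt reindex(2)] s[OF reindex(1)] s[OF \<sigma>] reindex by simp
    qed
  qed simp
  then show ?thesis by blast
qed

end


section \<open>Levels\<close>

text \<open>Both families are extensional on the same index set, so the entrywise condition in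
  \<open>lvl\<close> becomes an equation between functions.\<close>

lemma obj_lvl_iff:
  "(\<E>, r, w) \<in> obj (lvl k R) C \<longleftrightarrow>
     is_lc \<E> \<and> discrete \<E> \<and> ldom \<E> \<in> extensional (lvars \<E>) \<and> lc_solution (lc_pow k \<E>) R r \<and>
     w \<in> (\<Pi>\<^sub>E ys\<in>tuples (k - 1) (lvars \<E>). obj R (lvl_dom \<E> C ys)) \<and>
     (\<exists>z\<in>lvars \<E>. \<exists>\<beta>\<in>ldom \<E> z \<rightarrow> C. w = lvl_elt k R \<E> r C z \<beta>)"
proof -
  let ?Y = "tuples (k - 1) (lvars \<E>)"
  have "(\<forall>ys\<in>?Y. w ys = mor R (ldom (lc_pow k \<E>) (z # ys)) (lvl_dom \<E> C ys) (lvl_map k \<beta>) (r (z # ys)))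
      \<longleftrightarrow> w = lvl_elt k R \<E> r C z \<beta>"
    if "w \<in> (\<Pi>\<^sub>E ys\<in>?Y. obj R (lvl_dom \<E> C ys))" for z \<beta>
  proof -
    have "w \<in> extensional ?Y" using that by (simp add: PiE_iff)
    then show ?thesis
      by (auto simp: lvl_elt_def ldom_pow_Cons intro!: extensionalityI[of w ?Y])
  qed
  then show ?thesis unfolding lvl_def minion.simps mem_Collect_eq prod.case by blast
qed

context pow_solution
begin

text \<open>Entries of level elements are instances of \<open>push\<close> with identities after the
  first coordinate, which makes the results on \<open>push\<close> available for them.\<close>

lemma lvl_elt_tup:
  assumes n: "k = Suc n" and y: "tup n y \<in> tuples (k - 1) (lvars \<E>)"
  shows "lvl_elt k R \<E> r C z \<beta> (tup n y) =
    push (case_nat C (\<lambda>i. ldom \<E> (y i))) (case_nat z y) (case_nat \<beta> (\<lambda>_. id))"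
proof -
  have dom: "(\<lambda>i. ldom \<E> (case_nat z y i)) = case_nat (ldom \<E> z) (\<lambda>i. ldom \<E> (y i))"
    by (auto simp: fun_eq_iff split: nat.split)
  show ?thesis
    unfolding lvl_elt_def restrict_apply'[OF y] push_def dom
    by (simp add: lvl_dom_tup lvl_map_mapn n tup_Suc)
qed

lemma lvl_elt_in_lvl:
  assumes "discrete \<E>" "ldom \<E> \<in> extensional (lvars \<E>)" "finite C" "z \<in> lvars \<E>" "\<beta> \<in> ldom \<E> z \<rightarrow> C"
  shows "(\<E>, r, lvl_elt k R \<E> r C z \<beta>) \<in> obj (lvl k R) C"
proof -
  obtain n where n: "k = Suc n" using k by (cases k) auto
  have "lvl_elt k R \<E> r C z \<beta> ys \<in> obj R (lvl_dom \<E> C ys)" if ys: "ys \<in> tuples (k - 1) (lvars \<E>)" for ys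
  proof -
    obtain y where y: "ys = tup n y" "\<And>i. i < n \<Longrightarrow> y i \<in> lvars \<E>"
      using ys n by (auto elim: tuplesE)
    have "wt (case_nat C (\<lambda>i. ldom \<E> (y i))) (case_nat z y) (case_nat \<beta> (\<lambda>_. id))"
      using assms(3-5) y(2) unfolding wt_def by (auto simp: n finite_ldom split: nat.split)
    from push_obj[OF this] show ?thesis
      unfolding y(1) lvl_elt_tup[OF n ys[unfolded y(1)]] lvl_dom_tup n[symmetric] .
  qed
  then have "lvl_elt k R \<E> r C z \<beta> \<in> (\<Pi>\<^sub>E ys\<in>tuples (k - 1) (lvars \<E>). obj R (lvl_dom \<E> C ys))"
    by (auto simp: PiE_iff lvl_elt_def)
  then show ?thesis using assms \<E> r by (auto simp: obj_lvl_iff)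
qed

end

text \<open>The discrete instance is \<open>\<D>\<close> stripped of its constraints, and the value
  at \<open>x\<close> is induced by the variable \<open>x\<close> itself with the identity
  map.\<close>

lemma lvl_solution_of_pow_solution:
  fixes \<D> :: "('v, 'c elt) lc"
  assumes R: "is_minion R" and k: "k \<ge> 1" and wf: "lc_wf \<D>" and r_sol: "lc_solution (lc_pow k \<D>) R r"
  shows "\<exists>p. lc_solution \<D> (lvl k R) p"
proof -
  obtain f :: "'v \<Rightarrow> nat" where f: "inj_on f (lvars \<D>)"
    using finite_imp_inj_to_nat_seg[of "lvars \<D>"] wf by (auto simp: lc_wf_def)
  \<comment> \<open>Level elements require variables in \<open>'c elt\<close>. A number is encoded
    as a tuple of that length with empty tuples as entries.\<close>
  define e :: "'v \<Rightarrow> 'c elt" where "e x = Tup (replicate (f x) (Tup []))" for x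
  have e: "inj_on e (lvars \<D>)" using f by (auto simp: e_def inj_on_def)
  let ?Y = "e ` lvars \<D>" and ?d = "inv_into (lvars \<D>) e"
  have d: "?d v \<in> lvars \<D>" if "v \<in> ?Y" for v using that by (rule inv_into_into)
  have de: "?d (e x) = x" if "x \<in> lvars \<D>" for x using e that by simp
  define \<E> :: "('c elt, 'c elt) lc"
    where "\<E> = \<lparr> lvars = ?Y, ldom = (\<lambda>v\<in>?Y. ldom \<D> (?d v)), lcons = {} \<rparr>"
  have \<E>_simps: "lvars \<E> = ?Y" "\<And>v. v \<in> ?Y \<Longrightarrow> ldom \<E> v = ldom \<D> (?d v)" "lcons \<E> = {}"
    by (simp_all add: \<E>_def)
  have \<E>_lc: "is_lc \<E>" and \<E>_discrete: "discrete \<E>" "ldom \<E> \<in> extensional (lvars \<E>)"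
    using wf d by (auto simp: is_lc_def discrete_def \<E>_simps lc_wf_def) (simp add: \<E>_def)
  define r' where "r' = (\<lambda>vs\<in>tuples k ?Y. r (map ?d vs))"
  have r'_tup: "r' (tup k v) = r (tup k (\<lambda>i. ?d (v i)))" if "\<And>i. i < k \<Longrightarrow> v i \<in> ?Y" for v
    using that by (simp add: r'_def map_tup)
  have dom: "prodn k (\<lambda>i. ldom \<E> (v i)) = prodn k (\<lambda>i. ldom \<D> (?d (v i)))"
    if "\<And>i. i < k \<Longrightarrow> v i \<in> ?Y" for v
    using that by (intro prodn_cong) (simp add: \<E>_simps)
  have r'_obj: "r' (tup k v) \<in> obj R (prodn k (\<lambda>i. ldom \<E> (v i)))" if v: "\<And>i. i < k \<Longrightarrow> v i \<in> ?Y" for v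
  proof -
    have "tup k (\<lambda>i. ?d (v i)) \<in> lvars (lc_pow k \<D>)" using v d by simp
    from lc_solution_obj[OF r_sol this] show ?thesis using r'_tup[OF v] dom[OF v] by simp
  qed
  have r': "lc_solution (lc_pow k \<E>) R r'"
  proof (rule lc_solutionI)
    show "r' vs \<in> obj R (ldom (lc_pow k \<E>) vs)" if "vs \<in> lvars (lc_pow k \<E>)" for vs
      using that r'_obj by (auto simp: \<E>_simps elim!: tuplesE)
  next
    fix us \<gamma> vs assume "(us, \<gamma>, vs) \<in> lcons (lc_pow k \<E>)"
    then show "r' us = mor R (ldom (lc_pow k \<E>) vs) (ldom (lc_pow k \<E>) us) \<gamma> (r' vs)"
    proof (cases rule: lcons_pow_cases)
      case (product u \<alpha> v)
      \<comment> \<open>Since \<open>\<E>\<close> is discrete, its power has only products of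
        identities as product constraints.\<close>
      have *: "u i = v i" "\<alpha> i = id" "v i \<in> ?Y" if "i < k" for i
        using product(1)[OF that] by (auto simp: lcons_id_def \<E>_simps)
      have eq: "us = tup k v" "\<gamma> = mapn k \<alpha>" "vs = tup k v"
        using *(1) product(2) by (simp_all add: tup_eq_iff)
      have "finite (ldom \<E> (v i))" if "i < k" for i
        using *(3)[OF that] d lc_wf_finite[OF wf] by (simp add: \<E>_simps(2))
      then have "mor R (prodn k (\<lambda>i. ldom \<E> (v i))) (prodn k (\<lambda>i. ldom \<E> (v i))) (mapn k \<alpha>)
          (r' (tup k v)) = r' (tup k v)"
        using *(2) by (intro mor_mapn_id[OF R] r'_obj *(3))
      then show ?thesis unfolding eq ldom_pow ..
    next
      case (reindex v \<sigma>)
      have v: "v i \<in> ?Y" "v (\<sigma> i) \<in> ?Y" if "i < k" for i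
        using reindex(1,2) that by (auto simp: \<E>_simps)
      have "(tup k (\<lambda>i. ?d (v (\<sigma> i))), sigma_star k \<sigma>, tup k (\<lambda>i. ?d (v i))) \<in> lcons (lc_pow k \<D>)"
        using v d reindex(2) by (intro lcons_pow_reindex[where x = "\<lambda>i. ?d (v i)"]) auto
      from lc_solution_cons[OF r_sol this] show ?thesis
        using reindex(3) r'_tup[OF v(1)] r'_tup[OF v(2)] dom[OF v(1)] dom[OF v(2)] by simp
    qed
  qed (simp add: r'_def \<E>_simps)
  interpret pow_solution k R \<E> r' using R k \<E>_lc r' by unfold_locales
  obtain n where n: "k = Suc n" using k by (cases k) auto
  define w where "w x = lvl_elt k R \<E> r' (ldom \<D> x) (e x) id" for x
  have ex: "e x \<in> lvars \<E>" "ldom \<E> (e x) = ldom \<D> x" if "x \<in> lvars \<D>" for x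
    using that de by (auto simp: \<E>_simps)
  have "lc_solution \<D> (lvl k R) (\<lambda>x\<in>lvars \<D>. (\<E>, r', w x))"
  proof (rule lc_solutionI)
    show "(\<lambda>x\<in>lvars \<D>. (\<E>, r', w x)) x \<in> obj (lvl k R) (ldom \<D> x)" if "x \<in> lvars \<D>" for x
      using that ex[OF that] \<E>_discrete lc_wf_finite[OF wf that] by (simp add: w_def lvl_elt_in_lvl)
  next
    fix x \<alpha> y assume c: "(x, \<alpha>, y) \<in> lcons \<D>"
    note wfc = lc_wf_cons[OF wf c]
    have x: "x \<in> lvars \<D>" and y: "y \<in> lvars \<D>" and \<alpha>: "\<alpha> \<in> ldom \<D> y \<rightarrow> ldom \<D> x" using wfc by auto
    have "mor (lvl k R) (ldom \<D> y) (ldom \<D> x) \<alpha> (\<E>, r', w y) =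
        (\<E>, r', lvl_elt k R \<E> r' (ldom \<D> x) (e y) (\<alpha> \<circ> id))"
      unfolding w_def using ex[OF y] \<alpha> lc_wf_finite[OF wf] x y by (intro lvl_mor_elt) auto
    also have "lvl_elt k R \<E> r' (ldom \<D> x) (e y) (\<alpha> \<circ> id) = w x"
    proof (rule extensionalityI[of _ "tuples (k - 1) ?Y"])
      fix vs assume vs: "vs \<in> tuples (k - 1) ?Y"
      then obtain v where v: "vs = tup n v" "\<And>i. i < n \<Longrightarrow> v i \<in> ?Y" using n by (auto elim: tuplesE)
      have tv: "tup n v \<in> tuples (k - 1) (lvars \<E>)" using vs v(1) \<E>_simps(1) by simp
      have v': "\<And>i. i < n \<Longrightarrow> v i \<in> lvars \<E>" using v by (simp add: \<E>_simps)
      let ?C = "\<lambda>x. case_nat (ldom \<D> x) (\<lambda>i. ldom \<E> (v i))" and ?v = "\<lambda>x. case_nat (e x) v"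
      have v'': "?v x i \<in> ?Y" if "x \<in> lvars \<D>" "i < k" for x i
        using that v(2) by (auto simp: n split: nat.split)
      have dv: "tup k (\<lambda>i. ?d (?v x i)) = tup k (case_nat x (\<lambda>i. ?d (v i)))" if "x \<in> lvars \<D>" for x
        using that by (auto simp: tup_eq_iff de split: nat.split)
      have C: "prodn k (\<lambda>i. ldom \<D> (case_nat x (\<lambda>i. ?d (v i)) i)) = prodn k (?C x)"
          "(\<lambda>i. ldom \<E> (?v x i)) = ?C x" if "x \<in> lvars \<D>" for x
      proof -
        show "prodn k (\<lambda>i. ldom \<D> (case_nat x (\<lambda>i. ?d (v i)) i)) = prodn k (?C x)"
          using v(2) by (intro prodn_cong) (auto simp: n \<E>_simps split: nat.split)
        show "(\<lambda>i. ldom \<E> (?v x i)) = ?C x"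
          using ex(2)[OF that] by (auto simp: fun_eq_iff split: nat.split)
      qed
      have finC: "finite (?C x i)" if "x \<in> lvars \<D>" "i < k" for x i
        using that v' lc_wf_finite[OF wf] by (auto simp: n finite_ldom split: nat.split)
      have rx: "r' (tup k (?v x)) \<in> obj R (prodn k (?C x))" if "x \<in> lvars \<D>" for x
      proof -
        have "r' (tup k (?v x)) \<in> obj R (prodn k (\<lambda>i. ldom \<E> (?v x i)))"
          using v''[OF that] by (rule r'_obj)
        then show ?thesis unfolding C(2)[OF that] .
      qed
      have rv: "r' (tup k (?v x)) = r (tup k (case_nat x (\<lambda>i. ?d (v i))))" if "x \<in> lvars \<D>" for x
      proof -
        have "r' (tup k (?v x)) = r (tup k (\<lambda>i. ?d (?v x i)))" using v''[OF that] by (rule r'_tup)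
        then show ?thesis unfolding dv[OF that] .
      qed
      \<comment> \<open>The constraint between \<open>x\<close> and \<open>y\<close> in the first
        coordinate, with the added identity constraints in all others, is a product constraint of
        the power. It relates exactly the two entries to be compared.\<close>
      have "(tup k (case_nat x (\<lambda>i. ?d (v i))), mapn k (case_nat \<alpha> (\<lambda>_. id)), tup k (case_nat y (\<lambda>i. ?d (v i))))
          \<in> lcons (lc_pow k \<D>)"
        using c v(2) d by (intro lcons_pow_product) (auto simp: n lcons_id_def split: nat.split)
      from lc_solution_cons[OF r_sol this]
      have "r' (tup k (?v x)) = mor R (prodn k (?C y)) (prodn k (?C x)) (mapn k (case_nat \<alpha> (\<lambda>_. id)))
          (r' (tup k (?v y)))"
        using C(1)[OF x] C(1)[OF y] rv[OF x] rv[OF y] by simp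
      moreover have "mor R (prodn k (?C x)) (prodn k (?C x)) (mapn k (case_nat id (\<lambda>_. id))) (r' (tup k (?v x)))
          = r' (tup k (?v x))"
        using finC x by (intro mor_mapn_id[OF R _ _ rx]) (auto split: nat.split)
      ultimately show "lvl_elt k R \<E> r' (ldom \<D> x) (e y) (\<alpha> \<circ> id) vs = w x vs"
        unfolding w_def v(1) lvl_elt_tup[OF n tv] push_def C(2)[OF x] C(2)[OF y] by simp
    qed (simp_all add: lvl_elt_def w_def \<E>_simps)
    finally show "(\<lambda>x\<in>lvars \<D>. (\<E>, r', w x)) x =
        mor (lvl k R) (ldom \<D> y) (ldom \<D> x) \<alpha> ((\<lambda>x\<in>lvars \<D>. (\<E>, r', w x)) y)"
      using x y by simp
  qed simp
  then show ?thesis by blast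
qed

section \<open>The subminion of a level over a fixed pair \<open>(\<E>, r)\<close>\<close>

definition lvl_part ::
    "nat \<Rightarrow> ('c elt, 'm) minion \<Rightarrow> ('c elt, 'c elt) lc \<Rightarrow> ('c elt list \<Rightarrow> 'm) \<Rightarrow>
     ('c elt, ('c, 'm) level) minion" where
  "lvl_part k R \<E> r =
    \<lparr> obj = (\<lambda>C. {p \<in> obj (lvl k R) C. fst p = \<E> \<and> fst (snd p) = r}), mor = mor (lvl k R) \<rparr>"

lemma mor_lvl_fst: "fst (mor (lvl k R) C C' \<alpha> p) = fst p" "fst (snd (mor (lvl k R) C C' \<alpha> p)) = fst (snd p)"
  by (simp_all add: lvl_def case_prod_beta)

lemma is_minion_lvl_part:
  assumes "is_minion R" "k \<ge> 1"
  shows "is_minion (lvl_part k R \<E> r)"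
proof -
  note L = is_minion_lvl[OF assms]
  show ?thesis
  proof (rule is_minionI, goal_cases)
    case 1
    then show ?case using minion_mor[OF L 1(1-3)] by (simp add: lvl_part_def mor_lvl_fst)
  next
    case 2
    then show ?case using minion_cong[OF L 2(1-4)] by (simp add: lvl_part_def)
  next
    case 3
    then show ?case using minion_id[OF L 3(1)] by (simp add: lvl_part_def)
  next
    case 4
    then show ?case using minion_comp[OF L 4(1-5)] by (simp add: lvl_part_def)
  qed
qed

text \<open>An element over \<open>(\<E>, r)\<close> is determined by \<open>z\<close> and by the
  restriction of \<open>\<beta>\<close> to the domain of \<open>z\<close>, for which there are
  finitely many choices. This finiteness is what permits a finite instance as free
  structure.\<close>

lemma finite_lvl_part:
  assumes R: "is_minion R" and k: "k \<ge> 1" and C: "finite C"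
  shows "finite (obj (lvl_part k R \<E> r) C)"
proof (cases "is_lc \<E> \<and> lc_solution (lc_pow k \<E>) R r")
  case False
  have "obj (lvl_part k R \<E> r) C = {}"
  proof (rule equals0I)
    fix p assume "p \<in> obj (lvl_part k R \<E> r) C"
    then show False using False by (cases p) (auto simp: lvl_part_def obj_lvl_iff)
  qed
  then show ?thesis by simp
next
  case True
  interpret pow_solution k R \<E> r using R k True by unfold_locales auto
  obtain n where n: "k = Suc n" using k by (cases k) auto
  let ?e = "\<lambda>(z, \<beta>). (\<E>, r, lvl_elt k R \<E> r C z \<beta>)"
  \<comment> \<open>Functions in \<open>ldom \<E> z \<rightarrow> C\<close> are arbitrary off the
    domain; restricting leaves a finite set of them.\<close>
  have elt: "lvl_elt k R \<E> r C z \<beta> = lvl_elt k R \<E> r C z (restrict \<beta> (ldom \<E> z))"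
    if z: "z \<in> lvars \<E>" "\<beta> \<in> ldom \<E> z \<rightarrow> C" for z \<beta>
  proof (rule extensionalityI[of _ "tuples (k - 1) (lvars \<E>)"])
    fix ys assume ys: "ys \<in> tuples (k - 1) (lvars \<E>)"
    then obtain y where y: "ys = tup n y" "\<And>i. i < n \<Longrightarrow> y i \<in> lvars \<E>" using n by (auto elim: tuplesE)
    let ?z = "case_nat z y"
    have zy: "?z i \<in> lvars \<E>" if "i < k" for i using that z y(2) by (auto simp: n split: nat.split)
    show "lvl_elt k R \<E> r C z \<beta> ys = lvl_elt k R \<E> r C z (restrict \<beta> (ldom \<E> z)) ys"
      unfolding y(1) lvl_elt_tup[OF n ys[unfolded y(1)]] push_def
    proof (rule minion_cong[OF R])
      show "finite (prodn k (\<lambda>i. ldom \<E> (?z i)))" using zy by (intro finite_prodn finite_ldom)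
      show "finite (prodn k (case_nat C (\<lambda>i. ldom \<E> (y i))))"
        using C y(2) by (intro finite_prodn) (auto simp: n finite_ldom split: nat.split)
      show "mapn k (case_nat \<beta> (\<lambda>_. id)) \<in>
          prodn k (\<lambda>i. ldom \<E> (?z i)) \<rightarrow> prodn k (case_nat C (\<lambda>i. ldom \<E> (y i)))"
        using z by (intro mapn_funcset) (auto split: nat.split)
      show "r (tup k ?z) \<in> obj R (prodn k (\<lambda>i. ldom \<E> (?z i)))" using zy by (rule r_obj)
      show "mapn k (case_nat \<beta> (\<lambda>_. id)) u = mapn k (case_nat (restrict \<beta> (ldom \<E> z)) (\<lambda>_. id)) u"
        if "u \<in> prodn k (\<lambda>i. ldom \<E> (?z i))" for u
        using that by (fastforce simp: mem_prodn_iff tup_eq_iff n split: nat.split)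
    qed
  qed (simp_all add: lvl_elt_def)
  have "obj (lvl_part k R \<E> r) C \<subseteq> ?e ` (SIGMA z:lvars \<E>. ldom \<E> z \<rightarrow>\<^sub>E C)"
  proof
    fix p assume p: "p \<in> obj (lvl_part k R \<E> r) C"
    then obtain z \<beta> where z: "z \<in> lvars \<E>" "\<beta> \<in> ldom \<E> z \<rightarrow> C" "p = (\<E>, r, lvl_elt k R \<E> r C z \<beta>)"
      by (cases p) (auto simp: lvl_part_def obj_lvl_iff)
    then have "p = ?e (z, restrict \<beta> (ldom \<E> z))" using elt[OF z(1,2)] by simp
    then show "p \<in> ?e ` (SIGMA z:lvars \<E>. ldom \<E> z \<rightarrow>\<^sub>E C)" using z(1,2) by (intro image_eqI[of _ _ "(z, restrict \<beta> (ldom \<E> z))"]) auto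
  qed
  moreover have "finite (SIGMA z:lvars \<E>. ldom \<E> z \<rightarrow>\<^sub>E C)"
    using \<E> C by (intro finite_SigmaI finite_PiE) (auto simp: is_lc_def)
  ultimately show ?thesis using finite_surj by blast
qed


section \<open>Label cover instances of promise CSP instances\<close>

definition rel_dom :: "('s, 'c) rel_struct \<Rightarrow> 's \<Rightarrow> 'c elt set" where
  "rel_dom \<A> R = (\<lambda>t. Tup (map Atom t)) ` rel \<A> R"

lemma lc_of_simps [simp]:
  "lvars (lc_of \<A> \<I>) = Inl ` ivars \<I> \<union> Inr ` {..<length (icons \<I>)}"
  "ldom (lc_of \<A> \<I>) (Inl x) = Atom ` universe \<A>"
  "ldom (lc_of \<A> \<I>) (Inr j) = rel_dom \<A> (fst (icons \<I> ! j))"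
  by (simp_all add: lc_of_def rel_dom_def)

lemma lcons_lc_of_iff:
  "c \<in> lcons (lc_of \<A> \<I>) \<longleftrightarrow> (\<exists>i j. j < length (icons \<I>) \<and> i < length (snd (icons \<I> ! j)) \<and>
     c = (Inl (snd (icons \<I> ! j) ! i), \<lambda>u. comps u ! i, Inr j))"
  by (auto simp: lc_of_def)

lemma is_inst_nth:
  assumes "is_inst \<Sigma> \<I>" "j < length (icons \<I>)"
  shows "fst (icons \<I> ! j) \<in> syms \<Sigma>" "snd (icons \<I> ! j) \<in> tuples (ar \<Sigma> (fst (icons \<I> ! j))) (ivars \<I>)"
  using assms nth_mem[OF assms(2)] by (auto simp: is_inst_def case_prod_beta)

lemma finite_rel_dom:
  assumes "is_struct \<Sigma> \<A>" "R \<in> syms \<Sigma>"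
  shows "finite (rel_dom \<A> R)"
proof -
  have "rel \<A> R \<subseteq> tuples (ar \<Sigma> R) (universe \<A>)" "finite (universe \<A>)"
    using assms by (auto simp: is_struct_def)
  then show ?thesis unfolding rel_dom_def by (intro finite_imageI) (rule finite_subset[OF _ finite_tuples])
qed

lemma comps_rel_dom:
  assumes "is_struct \<Sigma> \<A>" "R \<in> syms \<Sigma>" "i < ar \<Sigma> R"
  shows "(\<lambda>u. comps u ! i) \<in> rel_dom \<A> R \<rightarrow> Atom ` universe \<A>"
  using assms by (fastforce simp: rel_dom_def is_struct_def tuples_def)

lemma lc_wf_lc_of:
  assumes \<A>: "is_struct \<Sigma> \<A>" and \<I>: "is_inst \<Sigma> \<I>"
  shows "lc_wf (lc_of \<A> \<I>)"
  unfolding lc_wf_def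
proof (intro conjI ballI)
  show "finite (lvars (lc_of \<A> \<I>))" using \<I> by (simp add: is_inst_def)
  show "finite (ldom (lc_of \<A> \<I>) x)" if "x \<in> lvars (lc_of \<A> \<I>)" for x
    using that \<A> finite_rel_dom[OF \<A> is_inst_nth(1)[OF \<I>]] by (auto simp: is_struct_def)
  show "case c of (x, \<alpha>, y) \<Rightarrow> x \<in> lvars (lc_of \<A> \<I>) \<and> y \<in> lvars (lc_of \<A> \<I>) \<and>
      \<alpha> \<in> ldom (lc_of \<A> \<I>) y \<rightarrow> ldom (lc_of \<A> \<I>) x" if c: "c \<in> lcons (lc_of \<A> \<I>)" for c
  proof -
    obtain i j where ij: "j < length (icons \<I>)" "i < length (snd (icons \<I> ! j))"
        "c = (Inl (snd (icons \<I> ! j) ! i), \<lambda>u. comps u ! i, Inr j)"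
      using c unfolding lcons_lc_of_iff by blast
    have "snd (icons \<I> ! j) ! i \<in> ivars \<I>" "i < ar \<Sigma> (fst (icons \<I> ! j))"
      using is_inst_nth(2)[OF \<I> ij(1)] ij(2) nth_mem[OF ij(2)] by (auto simp: tuples_def)
    then show ?thesis using ij comps_rel_dom[OF \<A> is_inst_nth(1)[OF \<I> ij(1)], of i] by auto
  qed
qed

text \<open>The polymorphism at a variable is evaluated at the identity of the universe. At a
  constraint, the projections of the relation form a tuple in the relation of the power, and its
  image is the required tuple in \<open>\<B>\<close>.\<close>

lemma solvable_if_lc_of_solution_Pol:
  assumes \<A>: "is_struct \<Sigma> \<A>" and \<I>: "is_inst \<Sigma> \<I>" and f: "lc_solution (lc_of \<A> \<I>) (Pol \<Sigma> \<A> \<B>) f"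
  shows "solvable_in \<I> \<B>"
proof -
  \<comment> \<open>The identity map of the universe up to the constructor \<open>Atom\<close>, as
    an element of the power.\<close>
  define a where "a = restrict (case_elt id (\<lambda>_. undefined)) (Atom ` universe \<A>)"
  have a: "a \<in> Atom ` universe \<A> \<rightarrow>\<^sub>E universe \<A>" "a (Atom c) = c" if "c \<in> universe \<A>" for c
    using that by (auto simp: a_def)
  have aE: "a \<in> Atom ` universe \<A> \<rightarrow>\<^sub>E universe \<A>" by (auto simp: a_def)
  let ?s = "\<lambda>x. f (Inl x) a"
  have "?s x \<in> universe \<B>" if "x \<in> ivars \<I>" for x
    using lc_solution_obj[OF f, of "Inl x"] that aE by (auto simp: obj_Pol_iff)
  moreover have "map ?s xs \<in> rel \<B> R" if Rxs: "(R, xs) \<in> set (icons \<I>)" for R xs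
  proof -
    obtain j where j: "j < length (icons \<I>)" "icons \<I> ! j = (R, xs)"
      using Rxs by (auto simp: in_set_conv_nth)
    have R: "R \<in> syms \<Sigma>" "length xs = ar \<Sigma> R"
      using is_inst_nth[OF \<I> j(1)] j(2) by (auto simp: tuples_def)
    \<comment> \<open>The \<open>i\<close>-th projection from the relation to the universe.\<close>
    let ?a = "\<lambda>i. restrict (a \<circ> (\<lambda>u. comps u ! i)) (rel_dom \<A> R)"
    let ?t = "tup (ar \<Sigma> R) ?a"
    have fj: "f (Inr j) \<in> obj (Pol \<Sigma> \<A> \<B>) (rel_dom \<A> R)"
      using lc_solution_obj[OF f, of "Inr j"] j by simp
    have "?a i \<in> rel_dom \<A> R \<rightarrow>\<^sub>E universe \<A>" if "i < ar \<Sigma> R" for i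
      using PiE_mem[OF aE funcset_mem[OF comps_rel_dom[OF \<A> R(1) that]]] by simp
    then have t: "?t \<in> tuples (ar \<Sigma> R) (rel_dom \<A> R \<rightarrow>\<^sub>E universe \<A>)"
      by (intro tup_in_tuples_iff[THEN iffD2] allI impI)
    have "map (\<lambda>b. b d) ?t \<in> rel \<A> R" if d: "d \<in> rel_dom \<A> R" for d
    proof -
      obtain c where c: "d = Tup (map Atom c)" "c \<in> rel \<A> R" using d by (auto simp: rel_dom_def)
      have "length c = ar \<Sigma> R" "set c \<subseteq> universe \<A>"
        using \<A> R c(2) by (auto simp: is_struct_def tuples_def)
      then have "map (\<lambda>b. b d) ?t = c"
        using d by (intro nth_equalityI) (auto simp: c(1) a(2) subset_iff)
      then show ?thesis using c(2) by simp
    qed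
    then have "map (f (Inr j)) ?t \<in> rel \<B> R" using fj R(1) t unfolding obj_Pol_iff by blast
    moreover have "map (f (Inr j)) ?t = map ?s xs"
    proof (intro nth_equalityI)
      fix i assume "i < length (map (f (Inr j)) ?t)"
      then have i: "i < ar \<Sigma> R" by simp
      have "(Inl (xs ! i), \<lambda>u. comps u ! i, Inr j) \<in> lcons (lc_of \<A> \<I>)"
        unfolding lcons_lc_of_iff using i j R by (intro exI[of _ i] exI[of _ j]) simp
      from lc_solution_cons[OF f this] show "map (f (Inr j)) ?t ! i = map ?s xs ! i"
        using i R j(2) aE by (simp add: Pol_def)
    qed (simp add: R)
    ultimately show ?thesis by metis
  qed
  ultimately show ?thesis unfolding solvable_in_def by (intro bexI[of _ ?s]) auto
qed

section \<open>The free structure of a locally finite minion\<close>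

text \<open>
  Homomorphisms \<open>S \<rightarrow> Pol(\<A>, \<B>)\<close> correspond to homomorphisms into \<open>\<B>\<close> from the free structure of
  \<open>S\<close>: its universe is \<open>obj S A\<close>, and each \<open>q \<in> obj S (R\<^sup>\<A>)\<close> contributes to its relation \<open>R\<close> the tuple
  of the images of \<open>q\<close> under the projections. As \<open>S\<close> is locally finite, this is an instance.
\<close>

lemma minion_hom_to_Pol_exists:
  fixes S :: "('c elt, 'm) minion" and \<A> :: "('s, 'c) rel_struct"
  assumes S: "is_minion S" and fin: "\<And>D. finite D \<Longrightarrow> finite (obj S D)"
    and \<A>: "is_struct \<Sigma> \<A>" and syms: "finite (syms \<Sigma>)"
    and inst: "\<And>(\<I> :: (nat, 's) pcsp_inst) P. is_inst \<Sigma> \<I> \<Longrightarrow> lc_solution (lc_of \<A> \<I>) S P \<Longrightarrow> solvable_in \<I> \<B>"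
  shows "\<exists>\<xi>. minion_hom \<xi> S (Pol \<Sigma> \<A> \<B>)"
proof -
  let ?U = "Atom ` universe \<A>"
  have U: "finite ?U" using \<A> by (simp add: is_struct_def)
  \<comment> \<open>Instances have natural numbers as variables, so the elements of the free
    structure are numbered.\<close>
  obtain e :: "'m \<Rightarrow> nat" where e: "inj_on e (obj S ?U)"
    using finite_imp_inj_to_nat_seg[OF fin[OF U]] by auto
  have "finite (SIGMA R:syms \<Sigma>. obj S (rel_dom \<A> R))"
    using syms fin finite_rel_dom[OF \<A>] by (intro finite_SigmaI) auto
  then obtain qs where qs: "set qs = (SIGMA R:syms \<Sigma>. obj S (rel_dom \<A> R))"
    using finite_list by blast
  define pr where "pr R q i = mor S (rel_dom \<A> R) ?U (\<lambda>u. comps u ! i) q" for R q i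
  have pr: "pr R q i \<in> obj S ?U" if "R \<in> syms \<Sigma>" "q \<in> obj S (rel_dom \<A> R)" "i < ar \<Sigma> R" for R q i
    unfolding pr_def using that comps_rel_dom[OF \<A>] finite_rel_dom[OF \<A>] U by (intro minion_mor[OF S])
  define \<I> where "\<I> = \<lparr> ivars = e ` obj S ?U,
    icons = map (\<lambda>(R, q). (R, map (\<lambda>i. e (pr R q i)) [0..<ar \<Sigma> R])) qs \<rparr>"
  have \<I>: "is_inst \<Sigma> \<I>"
    using fin[OF U] qs pr by (fastforce simp: is_inst_def \<I>_def tuples_def)
  \<comment> \<open>The tautological solution in \<open>S\<close>: a number stands for the element
    it encodes, and the \<open>j\<close>-th constraint for the element \<open>q\<close> that
    produced it.\<close>
  let ?P = "case_sum (inv_into (obj S ?U) e) (\<lambda>j. snd (qs ! j))"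
  have qs_nth: "fst (qs ! j) \<in> syms \<Sigma>" "snd (qs ! j) \<in> obj S (rel_dom \<A> (fst (qs ! j)))"
    if "j < length qs" for j
    using nth_mem[OF that] unfolding qs by auto
  have icons_nth: "icons \<I> ! j = (fst (qs ! j), map (\<lambda>i. e (pr (fst (qs ! j)) (snd (qs ! j)) i)) [0..<ar \<Sigma> (fst (qs ! j))])"
    if "j < length qs" for j
    using that by (simp add: \<I>_def case_prod_beta)
  have len: "length (icons \<I>) = length qs" by (simp add: \<I>_def)
  have "lc_solution (lc_of \<A> \<I>) S (restrict ?P (lvars (lc_of \<A> \<I>)))"
  proof (rule lc_solutionI)
    fix x assume "x \<in> lvars (lc_of \<A> \<I>)"
    then show "restrict ?P (lvars (lc_of \<A> \<I>)) x \<in> obj S (ldom (lc_of \<A> \<I>) x)"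
      using qs_nth(2) by (auto simp: len icons_nth) (simp add: \<I>_def inv_into_into)
  next
    fix x \<alpha> y assume c: "(x, \<alpha>, y) \<in> lcons (lc_of \<A> \<I>)"
    then obtain i j where ij: "j < length qs" "i < ar \<Sigma> (fst (qs ! j))"
        "x = Inl (e (pr (fst (qs ! j)) (snd (qs ! j)) i))" "\<alpha> = (\<lambda>u. comps u ! i)" "y = Inr j"
      by (auto simp: lcons_lc_of_iff icons_nth len)
    have "?P x = pr (fst (qs ! j)) (snd (qs ! j)) i"
      using ij e pr[OF qs_nth[OF ij(1)] ij(2)] by simp
    moreover have "x \<in> lvars (lc_of \<A> \<I>)" "y \<in> lvars (lc_of \<A> \<I>)"
      using lc_wf_cons[OF lc_wf_lc_of[OF \<A> \<I>] c] by auto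
    ultimately show "restrict ?P (lvars (lc_of \<A> \<I>)) x =
        mor S (ldom (lc_of \<A> \<I>) y) (ldom (lc_of \<A> \<I>) x) \<alpha> (restrict ?P (lvars (lc_of \<A> \<I>)) y)"
      using ij(1) unfolding ij(3-5) restrict_apply'[OF \<open>x \<in> lvars (lc_of \<A> \<I>)\<close>[unfolded ij(3)]]
        restrict_apply'[OF \<open>y \<in> lvars (lc_of \<A> \<I>)\<close>[unfolded ij(5)]] by (simp add: icons_nth pr_def)
  qed simp
  then obtain s where s: "s \<in> ivars \<I> \<rightarrow> universe \<B>" "\<And>R xs. (R, xs) \<in> set (icons \<I>) \<Longrightarrow> map s xs \<in> rel \<B> R"
    using inst[OF \<I>] unfolding solvable_in_def by blast
  have h: "s (e v) \<in> universe \<B>" if "v \<in> obj S ?U" for v using s(1) that by (auto simp: \<I>_def)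
  have h_rel: "map (\<lambda>i. s (e (pr R q i))) [0..<ar \<Sigma> R] \<in> rel \<B> R"
    if R: "R \<in> syms \<Sigma>" and q: "q \<in> obj S (rel_dom \<A> R)" for R q
  proof -
    have "(R, q) \<in> set qs" using R q qs by simp
    then have "(R, map (\<lambda>i. e (pr R q i)) [0..<ar \<Sigma> R]) \<in> set (icons \<I>)" by (force simp: \<I>_def)
    from s(2)[OF this] show ?thesis by (simp add: o_def)
  qed
  \<comment> \<open>Evaluation at \<open>a\<close> pushes \<open>p\<close> along \<open>a\<close>
    into the universe of the free structure and then reads off the solution
    \<open>s\<close>.\<close>
  define \<xi> where "\<xi> D p = (\<lambda>a\<in>D \<rightarrow>\<^sub>E universe \<A>. s (e (mor S D ?U (Atom \<circ> a) p)))" for D p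
  have "\<xi> D p \<in> obj (Pol \<Sigma> \<A> \<B>) D" if D: "finite D" and p: "p \<in> obj S D" for D p
    unfolding obj_Pol_iff
  proof (intro conjI ballI impI)
    show "\<xi> D p \<in> (D \<rightarrow>\<^sub>E universe \<A>) \<rightarrow>\<^sub>E universe \<B>"
      unfolding \<xi>_def using p D U by (intro restrict_PiE_iff[THEN iffD2] ballI h minion_mor[OF S]) auto
    fix R t assume R: "R \<in> syms \<Sigma>" and t: "t \<in> tuples (ar \<Sigma> R) (D \<rightarrow>\<^sub>E universe \<A>)"
      and rel: "\<forall>d\<in>D. map (\<lambda>a. a d) t \<in> rel \<A> R"
    \<comment> \<open>Evaluating \<open>t\<close> at a point of \<open>D\<close> gives a tuple of
      the relation. The image of \<open>p\<close> under this map has the coordinates of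
      \<open>map (\<xi> D p) t\<close>, before numbering and \<open>s\<close>, as its
      projections.\<close>
    let ?g = "\<lambda>d. Tup (map Atom (map (\<lambda>a. a d) t))"
    have g: "?g \<in> D \<rightarrow> rel_dom \<A> R" using rel unfolding rel_dom_def by (intro Pi_I imageI) blast
    have q: "mor S D (rel_dom \<A> R) ?g p \<in> obj S (rel_dom \<A> R)"
      using g by (intro minion_mor[OF S D finite_rel_dom[OF \<A> R] _ p])
    have "map (\<xi> D p) t = map (\<lambda>i. s (e (pr R (mor S D (rel_dom \<A> R) ?g p) i))) [0..<ar \<Sigma> R]"
    proof (rule nth_equalityI)
      show "length (map (\<xi> D p) t) = length (map (\<lambda>i. s (e (pr R (mor S D (rel_dom \<A> R) ?g p) i))) [0..<ar \<Sigma> R])"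
        using t by (simp add: tuples_def)
      fix i assume "i < length (map (\<xi> D p) t)"
      then have i: "i < ar \<Sigma> R" "i < length t" using t by (simp_all add: tuples_def)
      have ti: "t ! i \<in> D \<rightarrow>\<^sub>E universe \<A>" using t nth_mem[OF i(2)] by (auto simp: tuples_def)
      have "pr R (mor S D (rel_dom \<A> R) ?g p) i = mor S D ?U ((\<lambda>u. comps u ! i) \<circ> ?g) p"
        unfolding pr_def
        by (rule minion_comp[OF S D finite_rel_dom[OF \<A> R] U g comps_rel_dom[OF \<A> R i(1)] p, symmetric])
      also have "\<dots> = mor S D ?U (Atom \<circ> t ! i) p"
        using D U p i ti by (intro minion_cong[OF S, symmetric]) auto
      finally show "map (\<xi> D p) t ! i =
          map (\<lambda>i. s (e (pr R (mor S D (rel_dom \<A> R) ?g p) i))) [0..<ar \<Sigma> R] ! i"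
        using i ti by (simp add: \<xi>_def)
    qed
    then show "map (\<xi> D p) t \<in> rel \<B> R" using h_rel[OF R q] by metis
  qed
  moreover have "\<xi> E (mor S D E \<alpha> p) = mor (Pol \<Sigma> \<A> \<B>) D E \<alpha> (\<xi> D p)"
    if D: "finite D" and E: "finite E" and \<alpha>: "\<alpha> \<in> D \<rightarrow> E" and p: "p \<in> obj S D" for D E \<alpha> p
  proof -
    have "mor S E ?U (Atom \<circ> a) (mor S D E \<alpha> p) = mor S D ?U (Atom \<circ> restrict (a \<circ> \<alpha>) D) p"
        "restrict (a \<circ> \<alpha>) D \<in> D \<rightarrow>\<^sub>E universe \<A>"
      if a: "a \<in> E \<rightarrow>\<^sub>E universe \<A>" for a
    proof -
      have "mor S E ?U (Atom \<circ> a) (mor S D E \<alpha> p) = mor S D ?U ((Atom \<circ> a) \<circ> \<alpha>) p"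
        using a by (intro minion_comp[OF S D E U \<alpha> _ p, symmetric]) auto
      also have "\<dots> = mor S D ?U (Atom \<circ> restrict (a \<circ> \<alpha>) D) p"
        using a \<alpha> by (intro minion_cong[OF S D U _ _ p]) (auto simp: Pi_iff PiE_iff)
      finally show "mor S E ?U (Atom \<circ> a) (mor S D E \<alpha> p) = mor S D ?U (Atom \<circ> restrict (a \<circ> \<alpha>) D) p" .
      show "restrict (a \<circ> \<alpha>) D \<in> D \<rightarrow>\<^sub>E universe \<A>" using a \<alpha> by (auto simp: PiE_iff Pi_iff)
    qed
    then show ?thesis unfolding \<xi>_def Pol_def minion.simps by (intro restrict_ext) simp
  qed
  ultimately show ?thesis unfolding minion_hom_def by blast
qed


section \<open>The characterisation\<close>

lemma finite_csp_cons_arc_pow: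
  assumes "pcsp_template \<Sigma> \<A> \<B>" "lc_wf \<D>"
  shows "finite (csp_cons \<Sigma> \<A> (arc (lc_pow k \<D>)))"
proof -
  have wf: "lc_wf (arc (lc_pow k \<D>))" using assms(2) by (intro lc_wf_arc lc_wf_pow)
  show ?thesis
    by (rule finite_csp_cons[OF assms(1)]) (use wf in \<open>simp_all only: lc_wf_def\<close>)
qed

text \<open>Combines two passages: from \<open>csp\<close> to polymorphisms on the arc-consistent
  restriction, and from there to \<open>omega\<close> on the full power.\<close>

lemma k_consistency_solvable_iff:
  assumes "pcsp_template \<Sigma> \<A> \<B>" "is_struct \<Sigma>' \<A>'" "is_inst \<Sigma>' \<I>"
  shows "solvable_in (k_consistency k \<Sigma> \<A> \<A>' \<I>) \<B> \<longleftrightarrow>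
    (\<exists>s. lc_solution (lc_pow k (lc_of \<A>' \<I>)) (omega (Pol \<Sigma> \<A> \<B>)) s)"
proof -
  let ?\<D> = "lc_pow k (lc_of \<A>' \<I>)"
  have wf0: "lc_wf (lc_of \<A>' \<I>)" by (rule lc_wf_lc_of[OF assms(2,3)])
  then have wf: "lc_wf ?\<D>" by (rule lc_wf_pow)
  note fin = finite_csp_cons_arc_pow[OF assms(1) wf0, of k]
  have "solvable_in (k_consistency k \<Sigma> \<A> \<A>' \<I>) \<B> \<longleftrightarrow> (\<exists>f. lc_solution (arc ?\<D>) (Pol \<Sigma> \<A> \<B>) f)"
    unfolding k_consistency_def
    using lc_solution_Pol_if_csp_solvable[OF fin lc_wf_arc[OF wf]]
      csp_solvable_if_lc_solution_Pol[OF fin] by blast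
  also have "\<dots> \<longleftrightarrow> (\<exists>s. lc_solution ?\<D> (omega (Pol \<Sigma> \<A> \<B>)) s)"
    using lc_solution_arc_to_omega[OF is_minion_Pol wf] lc_solution_omega_to_arc[OF is_minion_Pol wf]
    by blast
  finally show ?thesis .
qed

text \<open>A solution labels the variables and constraints of the instance consistently. In the
  power the singletons of the induced labels are arc-consistent, so these labels survive in the
  largest family, and projecting to them solves the reduced instance.\<close>

lemma k_consistency_complete:
  assumes T: "pcsp_template \<Sigma> \<A> \<B>" and \<A>': "is_struct \<Sigma>' \<A>'" and \<I>: "is_inst \<Sigma>' \<I>"
    and sol: "solvable_in \<I> \<A>'"
  shows "solvable_in (k_consistency k \<Sigma> \<A> \<A>' \<I>) \<A>"
proof -
  let ?\<D> = "lc_of \<A>' \<I>"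
  obtain s where s: "s \<in> ivars \<I> \<rightarrow> universe \<A>'" "\<And>R xs. (R, xs) \<in> set (icons \<I>) \<Longrightarrow> map s xs \<in> rel \<A>' R"
    using sol unfolding solvable_in_def by blast
  define d where "d = case_sum (\<lambda>x. Atom (s x)) (\<lambda>j. Tup (map (\<lambda>x. Atom (s x)) (snd (icons \<I> ! j))))"
  have wf: "lc_wf ?\<D>" by (rule lc_wf_lc_of[OF \<A>' \<I>])
  have d: "d x \<in> ldom ?\<D> x" if "x \<in> lvars ?\<D>" for x
  proof (cases x)
    case (Inl v)
    then show ?thesis using that s(1) by (auto simp: d_def)
  next
    case (Inr j)
    then have "icons \<I> ! j \<in> set (icons \<I>)" using that by auto
    then have "map s (snd (icons \<I> ! j)) \<in> rel \<A>' (fst (icons \<I> ! j))" by (intro s(2)) simp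
    then show ?thesis using Inr by (auto simp: d_def rel_dom_def o_def image_iff intro!: rev_bexI)
  qed
  have d_cons: "\<alpha> (d y) = d x" if "(x, \<alpha>, y) \<in> lcons_id ?\<D>" for x \<alpha> y
    using that by (auto simp: lcons_id_def lcons_lc_of_iff d_def)
  define dd where "dd xs = Tup (map d xs)" for xs
  have dd: "dd (tup k x) = Tup (tup k (\<lambda>i. d (x i)))" for x by (simp add: dd_def map_tup)
  have dd_cons: "\<gamma> (dd ys) = dd xs" if "(xs, \<gamma>, ys) \<in> lcons (lc_pow k ?\<D>)" for xs \<gamma> ys
    using that
  proof (cases rule: lcons_pow_cases)
    case (product x \<alpha> y)
    then show ?thesis using d_cons[OF product(1)] by (auto simp: dd tup_eq_iff)
  next
    case (reindex x \<sigma>)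
    then show ?thesis by (simp add: dd)
  qed
  have "arc_consistent (lc_pow k ?\<D>) (\<lambda>xs. {dd xs})"
    unfolding arc_consistent_def
  proof (intro conjI ballI)
    fix xs assume "xs \<in> lvars (lc_pow k ?\<D>)"
    then obtain x where "xs = tup k x" "\<And>i. i < k \<Longrightarrow> x i \<in> lvars ?\<D>" unfolding lvars_pow by (blast elim: tuplesE)
    then show "{dd xs} \<subseteq> ldom (lc_pow k ?\<D>) xs" using d by (auto simp: dd mem_prodn_iff)
  next
    fix c assume "c \<in> lcons (lc_pow k ?\<D>)"
    then show "case c of (x, \<alpha>, y) \<Rightarrow> {dd x} = \<alpha> ` {dd y}" using dd_cons by (cases c) simp
  qed
  then have "dd xs \<in> ldom (arc (lc_pow k ?\<D>)) xs" for xs using arc_greatest by fastforce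
  then have "lc_solution (arc (lc_pow k ?\<D>)) (Pol \<Sigma> \<A> \<A>)
      (\<lambda>x\<in>lvars (arc (lc_pow k ?\<D>)). \<lambda>a\<in>ldom (arc (lc_pow k ?\<D>)) x \<rightarrow>\<^sub>E universe \<A>. a (dd x))"
    using dd_cons wf by (intro lc_solution_Pol_projections lc_wf_arc lc_wf_pow) auto
  then show ?thesis
    unfolding k_consistency_def by (rule csp_solvable_if_lc_solution_Pol[OF finite_csp_cons_arc_pow[OF T wf]])
qed

lemma lc_solution_lvl_part:
  "lc_solution \<D> (lvl_part k R \<E> r) P \<Longrightarrow> lc_solution \<D> (lvl k R) P"
  unfolding lc_solution_def lvl_part_def by (auto simp: PiE_iff)

text \<open>
  The maps of \<open>lvl k R\<close> keep \<open>(\<E>, r)\<close>, so a homomorphism can be chosen separately for each \<open>(\<E>, r)\<close>.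
\<close>

lemma minion_hom_lvl_glue:
  fixes R :: "('c elt, 'm) minion" and S :: "('c elt, 'n) minion"
  assumes "\<And>\<E> r. \<exists>\<xi>. minion_hom \<xi> (lvl_part k R \<E> r) S"
  shows "\<exists>\<xi>. minion_hom \<xi> (lvl k R) S"
proof -
  obtain \<Xi> where \<Xi>: "\<And>\<E> r. minion_hom (\<Xi> \<E> r) (lvl_part k R \<E> r) S" using assms by metis
  have part: "p \<in> obj (lvl_part k R (fst p) (fst (snd p))) D" if "p \<in> obj (lvl k R) D" for p D
    using that by (simp add: lvl_part_def)
  have "minion_hom (\<lambda>D p. \<Xi> (fst p) (fst (snd p)) D p) (lvl k R) S"
    unfolding minion_hom_def
  proof (intro conjI allI impI ballI funcsetI)
    fix D p assume "finite D" "p \<in> obj (lvl k R) D"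
    then show "\<Xi> (fst p) (fst (snd p)) D p \<in> obj S D"
      using \<Xi>[of "fst p" "fst (snd p)"] part[of p D] by (auto simp: minion_hom_def)
  next
    fix D E :: "'c elt set" and \<alpha> p
    assume "finite D" "finite E" "\<alpha> \<in> D \<rightarrow> E" "p \<in> obj (lvl k R) D"
    then have "\<Xi> (fst p) (fst (snd p)) E (mor (lvl_part k R (fst p) (fst (snd p))) D E \<alpha> p) =
        mor S D E \<alpha> (\<Xi> (fst p) (fst (snd p)) D p)"
      using \<Xi>[of "fst p" "fst (snd p)"] part[of p D] by (simp add: minion_hom_def)
    then show "\<Xi> (fst (mor (lvl k R) D E \<alpha> p)) (fst (snd (mor (lvl k R) D E \<alpha> p))) E (mor (lvl k R) D E \<alpha> p) =
        mor S D E \<alpha> (\<Xi> (fst p) (fst (snd p)) D p)"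
      by (simp add: mor_lvl_fst lvl_part_def)
  qed
  then show ?thesis by blast
qed

theorem theorem6p14:
  fixes \<Sigma> :: "'s signat" and \<A> :: "('s, 'a) rel_struct" and \<B> :: "('s, 'b) rel_struct"
    and \<Sigma>' :: "'t signat" and \<A>' :: "('t, 'c) rel_struct" and \<B>' :: "('t, 'd) rel_struct"
    and k :: nat
  assumes "pcsp_template \<Sigma> \<A> \<B>" and "pcsp_template \<Sigma>' \<A>' \<B>'" and "k \<ge> 1"
  shows "reduces_via_k_consistency k \<Sigma>' \<A>' \<B>' \<Sigma> \<A> \<B> \<longleftrightarrow>
    (\<exists>\<xi>. minion_hom \<xi> (lvl k (omega (Pol \<Sigma> \<A> \<B> :: ('c elt, ('c elt \<Rightarrow> 'a) \<Rightarrow> 'b) minion)))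
                     (Pol \<Sigma>' \<A>' \<B>'))"
proof -
  let ?R = "omega (Pol \<Sigma> \<A> \<B> :: ('c elt, ('c elt \<Rightarrow> 'a) \<Rightarrow> 'b) minion)"
  have R: "is_minion ?R" by (intro is_minion_omega is_minion_Pol)
  have \<A>': "is_struct \<Sigma>' \<A>'" and syms: "finite (syms \<Sigma>')"
    using assms(2) by (simp_all add: pcsp_template_def)
  show ?thesis
  proof
    assume red: "reduces_via_k_consistency k \<Sigma>' \<A>' \<B>' \<Sigma> \<A> \<B>"
    show "\<exists>\<xi>. minion_hom \<xi> (lvl k ?R) (Pol \<Sigma>' \<A>' \<B>')"
    proof (rule minion_hom_lvl_glue)
      fix \<E> r
      show "\<exists>\<xi>. minion_hom \<xi> (lvl_part k ?R \<E> r) (Pol \<Sigma>' \<A>' \<B>')"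
      proof (cases "is_lc \<E> \<and> lc_solution (lc_pow k \<E>) ?R r")
        case False
        \<comment> \<open>This part of the level is empty, so any family of maps is a
          homomorphism.\<close>
        then have "obj (lvl_part k ?R \<E> r) D = {}" for D
          by (auto simp: lvl_part_def obj_lvl_iff)
        then show ?thesis by (simp add: minion_hom_def)
      next
        case True
        interpret pow_solution k ?R \<E> r using R assms(3) True by unfold_locales auto
        show ?thesis
        proof (rule minion_hom_to_Pol_exists[OF is_minion_lvl_part[OF R assms(3)]
                finite_lvl_part[OF R assms(3)] \<A>' syms])
          fix \<I> :: "(nat, 't) pcsp_inst" and P
          assume \<I>: "is_inst \<Sigma>' \<I>" and P: "lc_solution (lc_of \<A>' \<I>) (lvl_part k ?R \<E> r) P"
          \<comment> \<open>All values of \<open>P\<close> lie over the fixed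
            \<open>(\<E>, r)\<close>, as the passage to the power requires. The resulting solution
            makes the reduced instance solvable in \<open>\<B>\<close>, and \<open>red\<close>
            brings this back to \<open>\<I>\<close>.\<close>
          have "\<exists>z\<in>lvars \<E>. \<exists>\<beta>\<in>ldom \<E> z \<rightarrow> ldom (lc_of \<A>' \<I>) x.
              P x = (\<E>, r, lvl_elt k ?R \<E> r (ldom (lc_of \<A>' \<I>) x) z \<beta>)" if "x \<in> lvars (lc_of \<A>' \<I>)" for x
            using lc_solution_obj[OF P that] by (cases "P x") (auto simp: lvl_part_def obj_lvl_iff)
          then have "\<exists>s. lc_solution (lc_pow k (lc_of \<A>' \<I>)) ?R s"
            by (rule pow_solution_of_lvl_solution[OF lc_wf_lc_of[OF \<A>' \<I>] lc_solution_lvl_part[OF P]])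
          then show "solvable_in \<I> \<B>'"
            using red \<I> k_consistency_solvable_iff[OF assms(1) \<A>' \<I>]
            by (simp add: reduces_via_k_consistency_def)
        qed
      qed
    qed
  next
    assume "\<exists>\<xi>. minion_hom \<xi> (lvl k ?R) (Pol \<Sigma>' \<A>' \<B>')"
    then obtain \<xi> where \<xi>: "minion_hom \<xi> (lvl k ?R) (Pol \<Sigma>' \<A>' \<B>')" by blast
    \<comment> \<open>Soundness: solvability in \<open>\<B>\<close> gives a solution of the power in
      \<open>omega\<close>, hence one of the label cover instance in the level; \<open>\<xi>\<close>
      carries it to polymorphisms, and evaluation solves \<open>\<I>\<close>.\<close>
    have "solvable_in \<I> \<B>'"
      if \<I>: "is_inst \<Sigma>' \<I>" and sol: "solvable_in (k_consistency k \<Sigma> \<A> \<A>' \<I>) \<B>"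
      for \<I> :: "(nat, 't) pcsp_inst"
    proof -
      have wf: "lc_wf (lc_of \<A>' \<I>)" by (rule lc_wf_lc_of[OF \<A>' \<I>])
      obtain s where "lc_solution (lc_pow k (lc_of \<A>' \<I>)) ?R s"
        using sol k_consistency_solvable_iff[OF assms(1) \<A>' \<I>] by blast
      then obtain p where "lc_solution (lc_of \<A>' \<I>) (lvl k ?R) p"
        using lvl_solution_of_pow_solution[OF R assms(3) wf] by blast
      from solvable_if_lc_of_solution_Pol[OF \<A>' \<I> lc_solution_hom[OF \<xi> wf this]] show ?thesis .
    qed
    then show "reduces_via_k_consistency k \<Sigma>' \<A>' \<B>' \<Sigma> \<A> \<B>"
      unfolding reduces_via_k_consistency_def using k_consistency_complete[OF assms(1) \<A>'] by blast
  qed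
qed

end
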